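(* Let $\mu,\nu\in\mathcal P_1(\mathbb R)$. There exists an admissible map $T\colon\mathbb R\to\mathbb R$ (admissible with respect to $(\mu,\nu)$), unique up to $\mu$-a.s. equality, which is maximal in the sense that $S(\mu)\leq_c T(\mu)$ for every other admissible map $S$. Moreover, if $\theta\colon\mathbb R\to\mathbb R$ is convex, then $\mu^*:=T(\mu)$ is an optimizer of $$V_\theta(\mu,\nu):=\inf_{\mu^*\leq_c\nu}W_\theta(\mu,\mu^* ).$$ If $\theta\colon\mathbb R\to\mathbb R$ is strictly convex and $V_\theta(\mu,\nu)$ is finite, then $T(\mu)$ is the unique optimizer of this problem.
   Context: $\mathcal P_1(\mathbb R)$ is the set of Borel probability measures on $\mathbb R$ with finite first moment. For a measurable map $S$, $S(\mu)$ denotes the push-forward of $\mu$ under $S$. For $\eta,\nu\in\mathcal P_1(\mathbb R)$, $\eta\leq_c\nu$ (convex order) means $\int\phi\,d\eta\leq\int\phi\,d\nu$ for all convex $\phi\colon\mathbb R\to\mathbb R$. $\Pi(\mu,\eta)$ is the set of couplings of $\mu$ and $\eta$, and for convex $\theta$, $W_\theta(\mu,\eta):=\inf_{\pi\in\Pi(\mu,\eta)}\int_{\mathbb R\times\mathbb R}\theta(x-y)\,\pi(dx,dy)\in(-\infty,+\infty]$. A function $S\colon\mathbb R\to\mathbb R$ is called admissible (with respect to $\mu,\nu\in\mathcal P_1(\mathbb R)$) if (i) $S$ is increasing (i.e. nondecreasing), (ii) $S$ is 1-Lipschitz, and (iii) $S(\mu)\leq_c\nu$. *)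

theory Defs
  imports "HOL-Probability.Probability"
begin

definition P1 :: "real measure set" where
  "P1 = {\<mu>. real_distribution \<mu> \<and> integrable \<mu> (\<lambda>x. x)}"

(* The integral as an extended real, i.e. the integral of the positive part minus that of the
   negative part (ennreal truncates negative reals to 0).  It is applied to convex functions of
   a variable with finite first moment: these are bounded below by an affine function, so the
   negative part has finite integral and the difference is never infinity minus infinity. *)
definition ext_integral :: "'a measure \<Rightarrow> ('a \<Rightarrow> real) \<Rightarrow> ereal" where
  "ext_integral M f =
     enn2ereal (\<integral>\<^sup>+ x. ennreal (f x) \<partial>M) - enn2ereal (\<integral>\<^sup>+ x. ennreal (- f x) \<partial>M)"

lemma ext_integral_eq_lebesgue_integral:
  assumes "integrable M f"
  shows "ext_integral M f = ereal (integral\<^sup>L M f)"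
proof -
  have 1: "(\<integral>\<^sup>+ x. ennreal (f x) \<partial>M) < \<infinity>" "(\<integral>\<^sup>+ x. ennreal (- f x) \<partial>M) < \<infinity>"
    using assms by (auto simp: real_integrable_def top.not_eq_extremum)
  then obtain a b where "0 \<le> a" "(\<integral>\<^sup>+ x. ennreal (f x) \<partial>M) = ennreal a"
      "0 \<le> b" "(\<integral>\<^sup>+ x. ennreal (- f x) \<partial>M) = ennreal b"
    by (auto simp: less_top_ennreal)
  then show ?thesis
    unfolding ext_integral_def real_lebesgue_integral_def[OF assms] by simp
qed

definition convex_le :: "real measure \<Rightarrow> real measure \<Rightarrow> bool"  (infix \<open>\<le>\<^sub>c\<close> 50) where
  "\<eta> \<le>\<^sub>c \<nu> \<longleftrightarrow>
     (\<forall>\<phi> :: real \<Rightarrow> real. convex_on UNIV \<phi> \<longrightarrow> ext_integral \<eta> \<phi> \<le> ext_integral \<nu> \<phi>)"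

definition strictly_convex :: "(real \<Rightarrow> real) \<Rightarrow> bool" where
  "strictly_convex f \<longleftrightarrow>
     (\<forall>x y u v. x \<noteq> y \<longrightarrow> 0 < u \<longrightarrow> 0 < v \<longrightarrow> u + v = 1 \<longrightarrow> f (u * x + v * y) < u * f x + v * f y)"

definition pushforward :: "(real \<Rightarrow> real) \<Rightarrow> real measure \<Rightarrow> real measure" where
  "pushforward S \<mu> = distr \<mu> borel S"

definition couplings :: "real measure \<Rightarrow> real measure \<Rightarrow> (real \<times> real) measure set" where
  "couplings \<mu> \<eta> =
     {\<pi>. sets \<pi> = sets (borel \<Otimes>\<^sub>M borel) \<and> distr \<pi> borel fst = \<mu> \<and> distr \<pi> borel snd = \<eta>}"

definition W :: "(real \<Rightarrow> real) \<Rightarrow> real measure \<Rightarrow> real measure \<Rightarrow> ereal" where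
  "W \<theta> \<mu> \<eta> = (INF \<pi> \<in> couplings \<mu> \<eta>. ext_integral \<pi> (\<lambda>(x, y). \<theta> (x - y)))"

definition V :: "(real \<Rightarrow> real) \<Rightarrow> real measure \<Rightarrow> real measure \<Rightarrow> ereal" where
  "V \<theta> \<mu> \<nu> = (INF \<eta> \<in> {\<eta> \<in> P1. \<eta> \<le>\<^sub>c \<nu>}. W \<theta> \<mu> \<eta>)"

definition V_optimizer ::
    "(real \<Rightarrow> real) \<Rightarrow> real measure \<Rightarrow> real measure \<Rightarrow> real measure \<Rightarrow> bool" where
  "V_optimizer \<theta> \<mu> \<nu> \<eta> \<longleftrightarrow> \<eta> \<in> P1 \<and> \<eta> \<le>\<^sub>c \<nu> \<and> W \<theta> \<mu> \<eta> = V \<theta> \<mu> \<nu>"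

definition admissible :: "real measure \<Rightarrow> real measure \<Rightarrow> (real \<Rightarrow> real) \<Rightarrow> bool" where
  "admissible \<mu> \<nu> S \<longleftrightarrow> mono S \<and> 1-lipschitz_on UNIV S \<and> pushforward S \<mu> \<le>\<^sub>c \<nu>"

definition maximal_admissible :: "real measure \<Rightarrow> real measure \<Rightarrow> (real \<Rightarrow> real) \<Rightarrow> bool" where
  "maximal_admissible \<mu> \<nu> T \<longleftrightarrow>
     admissible \<mu> \<nu> T \<and> (\<forall>S. admissible \<mu> \<nu> S \<longrightarrow> pushforward S \<mu> \<le>\<^sub>c pushforward T \<mu>)"

end

(* Encode a measure by its potential U_mu(c) = E (c - X)^+; for equal means, convex order is the
   pointwise order of potentials.  For every coupling of X ~ mu with Y <=_c nu, subadditivity of the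
   positive part gives U_mu(y + c) <= U_nu(y) + U_(X - Y)(c), so the potential of X - Y dominates
   R(c) = sup_y (U_mu(y + c) - U_nu(y)).  Monotone comparative statics applied to the maximizers of
   this supremum yields a map g for which g and id - g are both nondecreasing, and the envelope
   theorem identifies R as the potential of g(mu).  Hence g(mu) is the least element, in convex
   order, among the laws of X - Y; this makes T = id - g optimal for all convex costs at once, and
   dually T(mu) the greatest admissible image. *)

theory Submission
  imports Defs
begin

section \<open>Extended integrals and convex functions\<close>

text \<open>The bound on \<open>R\<close> says something about \<open>T\<close> because
  subadditivity becomes an equality along \<open>x = T x + residual x\<close>: both summands are
  nondecreasing, so the positive parts add exactly. This gives the potential of an image of
  \<open>\<mu>\<close> at the values of the map, and a comparison at those values is enough. The
  supremum defining \<open>R\<close> need not be attained: its argument tends to 0 at minus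
  infinity, and at plus infinity to \<open>c\<close> minus the difference of the two means.
  Maximizers are therefore replaced by the down-closed set of points beyond which the supremum is
  still approached, and the map g is the generalized inverse of this family in \<open>c\<close>. The
  means of \<open>\<mu>\<close> and \<open>\<nu>\<close> may differ; the difference is the mean of
  g(mu). A common subgradient determines the potential only up to a constant, so the limit of
  \<open>R\<close> at minus infinity supplies the constant, and the behaviour at plus infinity
  supplies the mean.\<close>

lemma ext_integral_distr:
  assumes "f \<in> borel_measurable M" "\<phi> \<in> borel_measurable borel"
  shows "ext_integral (distr M borel f) \<phi> = ext_integral M (\<lambda>x. \<phi> (f x))"
  using assms by (simp add: ext_integral_def nn_integral_distr)

text \<open>Meant for a convex function written as its excess \<open>h\<close> over a tangent plus
  the tangent \<open>g\<close>. When the excess has infinite integral, the negative part of the sum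
  is still bounded by the absolute value of \<open>g\<close>, so no infinity minus infinity
  arises.\<close>

lemma ext_integral_nonneg_add:
  assumes h: "h \<in> borel_measurable M" "\<And>x. 0 \<le> h x" and g: "integrable M g"
  shows "ext_integral M (\<lambda>x. h x + g x) = enn2ereal (\<integral>\<^sup>+x. h x \<partial>M) + ereal (\<integral>x. g x \<partial>M)"
proof (cases "(\<integral>\<^sup>+x. h x \<partial>M) = \<infinity>")
  case False
  then have hi: "integrable M h"
    using h by (intro integrableI_nonneg) (auto simp: less_top)
  have "(\<integral>\<^sup>+x. h x \<partial>M) = ennreal (\<integral>x. h x \<partial>M)"
    using h hi by (intro nn_integral_eq_integral) auto
  then show ?thesis
    using hi g h by (subst ext_integral_eq_lebesgue_integral) (auto simp: enn2ereal_ennreal)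
next
  case True
  have gm: "g \<in> borel_measurable M" using g by auto
  have ga: "(\<integral>\<^sup>+x. ennreal \<bar>g x\<bar> \<partial>M) < \<infinity>"
    using g by (simp add: integrable_iff_bounded)
  have "(\<integral>\<^sup>+x. h x \<partial>M) \<le> (\<integral>\<^sup>+x. ennreal (h x + g x) + ennreal \<bar>g x\<bar> \<partial>M)"
  proof (intro nn_integral_mono)
    fix x
    have "ennreal (h x) \<le> ennreal (max 0 (h x + g x) + \<bar>g x\<bar>)" by (intro ennreal_leI) auto
    also have "\<dots> = ennreal (h x + g x) + ennreal \<bar>g x\<bar>"
      by (subst ennreal_plus) (auto simp: max_def ennreal_neg)
    finally show "ennreal (h x) \<le> ennreal (h x + g x) + ennreal \<bar>g x\<bar>" .
  qed
  also have "\<dots> = (\<integral>\<^sup>+x. ennreal (h x + g x) \<partial>M) + (\<integral>\<^sup>+x. ennreal \<bar>g x\<bar> \<partial>M)"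
    using h gm by (intro nn_integral_add) auto
  finally have pos: "(\<integral>\<^sup>+x. ennreal (h x + g x) \<partial>M) = \<infinity>"
    using True ga by (auto simp: top_unique less_top)
  have "(\<integral>\<^sup>+x. ennreal (- (h x + g x)) \<partial>M) \<le> (\<integral>\<^sup>+x. ennreal \<bar>g x\<bar> \<partial>M)"
    using h(2) by (intro nn_integral_mono ennreal_leI) (smt (verit))
  then have neg: "(\<integral>\<^sup>+x. ennreal (- (h x + g x)) \<partial>M) < \<infinity>"
    using ga by (rule le_less_trans)
  then obtain r where "0 \<le> r" "(\<integral>\<^sup>+x. ennreal (- (h x + g x)) \<partial>M) = ennreal r"
    by (auto simp: less_top_ennreal)
  then show ?thesis
    using True pos unfolding ext_integral_def by (simp add: enn2ereal_ennreal)
qed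

lemma convex_continuous_real: "convex_on UNIV \<phi> \<Longrightarrow> continuous_on UNIV (\<phi> :: real \<Rightarrow> real)"
  by (rule convex_on_continuous) auto

lemma convex_measurable: "convex_on UNIV \<phi> \<Longrightarrow> (\<phi> :: real \<Rightarrow> real) \<in> borel_measurable borel"
  by (intro borel_measurable_continuous_onI convex_continuous_real)

text \<open>A selection of one supporting slope at each point rather than the full subdifferential.
  It serves for the convex test functions and later, with the selection \<open>cdf \<rho>\<close>,
  for comparing \<open>R\<close> with a potential.\<close>

definition subgradient :: "(real \<Rightarrow> real) \<Rightarrow> (real \<Rightarrow> real) \<Rightarrow> bool" where
  "subgradient \<phi> p \<longleftrightarrow> (\<forall>x y. \<phi> x + p x * (y - x) \<le> \<phi> y)"

lemma convex_imp_subgradient: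
  assumes "convex_on UNIV \<phi>"
  obtains p where "subgradient \<phi> p"
proof
  \<comment> \<open>The infimum of the difference quotients to the right of \<open>x\<close> is the
    right derivative.\<close>
  show "subgradient \<phi> (\<lambda>x. Inf ((\<lambda>t. (\<phi> x - \<phi> t) / (x - t)) ` ({x<..} \<inter> UNIV)))"
    unfolding subgradient_def using convex_le_Inf_differential[OF assms] by auto
qed

definition tangent :: "(real \<Rightarrow> real) \<Rightarrow> (real \<Rightarrow> real) \<Rightarrow> real \<Rightarrow> real \<Rightarrow> real" where
  "tangent \<phi> p k x = \<phi> k + p k * (x - k)"

lemma tangent_le: "subgradient \<phi> p \<Longrightarrow> tangent \<phi> p k x \<le> \<phi> x"
  unfolding subgradient_def tangent_def by blast

lemma subgradient_mono:
  assumes "subgradient \<phi> p" "a \<le> b"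
  shows "p a \<le> p b"
proof (cases "a = b")
  case False
  have "\<phi> a + p a * (b - a) \<le> \<phi> b" "\<phi> b + p b * (a - b) \<le> \<phi> a"
    using assms(1) by (auto simp: subgradient_def)
  then have "p a * (b - a) \<le> p b * (b - a)" by (simp add: algebra_simps)
  then show ?thesis using False assms(2) by (simp add: mult_le_cancel_right)
qed auto

text \<open>The tangent at \<open>m\<close> touches the function there, so it is on top at
  \<open>m\<close>, and its slope is at least that of the tangent at \<open>k\<close>.\<close>

lemma tangent_le_right:
  assumes "subgradient \<phi> p" "k \<le> m" "m \<le> x"
  shows "tangent \<phi> p k x \<le> tangent \<phi> p m x"
proof -
  have "p k * (x - m) \<le> p m * (x - m)"
    using subgradient_mono[OF assms(1,2)] assms(3) by (intro mult_right_mono) auto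
  moreover have "\<phi> k + p k * (m - k) \<le> \<phi> m" using assms(1) by (auto simp: subgradient_def)
  ultimately show ?thesis by (simp add: tangent_def algebra_simps)
qed

lemma tangent_le_left:
  assumes "subgradient \<phi> p" "k \<le> m" "x \<le> k"
  shows "tangent \<phi> p m x \<le> tangent \<phi> p k x"
proof -
  have "p k * (k - x) \<le> p m * (k - x)"
    using subgradient_mono[OF assms(1,2)] assms(3) by (intro mult_right_mono) auto
  moreover have "\<phi> m + p m * (k - m) \<le> \<phi> k" using assms(1) by (auto simp: subgradient_def)
  ultimately show ?thesis by (simp add: tangent_def algebra_simps)
qed

text \<open>A maximum of finitely many tangents, taken in increasing order of the contact points,
  arises from an affine function by adding call functions one at a time.\<close>

lemma Max_tangent_induct:
  fixes P :: "(real \<Rightarrow> real) \<Rightarrow> bool"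
  assumes sub: "subgradient \<phi> p" and "finite K" "K \<noteq> {}"
    and affine: "\<And>a b. P (\<lambda>x. a + b * x)"
    and call: "\<And>\<psi> a z. P \<psi> \<Longrightarrow> 0 \<le> a \<Longrightarrow> P (\<lambda>x. \<psi> x + a * max 0 (x - z))"
  shows "P (\<lambda>x. Max ((\<lambda>k. tangent \<phi> p k x) ` K))"
  using assms(2,3)
proof (induction K rule: finite_linorder_max_induct)
  case empty
  then show ?case by simp
next
  case (insert b A)
  define Q where "Q x = Max ((\<lambda>k. tangent \<phi> p k x) ` A)" for x
  show ?case
  proof (cases "A = {}")
    case True
    have "(\<lambda>x. Max ((\<lambda>k. tangent \<phi> p k x) ` insert b A)) = (\<lambda>x. (\<phi> b - p b * b) + p b * x)"
      using True by (auto simp: tangent_def algebra_simps)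
    then show ?thesis using affine by metis
  next
    case False
    define m where "m = Max A"
    have mA: "m \<in> A" and mge: "\<And>k. k \<in> A \<Longrightarrow> k \<le> m" and mb: "m < b"
      using False insert.hyps by (auto simp: m_def)
    have PQ: "P Q" using insert.IH False by (simp add: Q_def[abs_def])
    have Q_right: "Q x = tangent \<phi> p m x" if "m \<le> x" for x
      unfolding Q_def using mA mge that insert.hyps(1)
      by (intro Max_eqI) (auto intro: tangent_le_right[OF sub])
    have Q_ge: "tangent \<phi> p m x \<le> Q x" for x
      unfolding Q_def using mA insert.hyps(1) by (intro Max_ge) auto
    have step: "Max ((\<lambda>k. tangent \<phi> p k x) ` insert b A) = max (tangent \<phi> p b x) (Q x)" for x
      unfolding Q_def using False insert.hyps(1) by (simp add: Max_insert)
    have left: "tangent \<phi> p b x \<le> Q x" if "x \<le> m" for x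
      using tangent_le_left[OF sub _ that, of b] mb Q_ge[of x] by linarith
    have bm: "\<phi> b + p b * (m - b) \<le> \<phi> m" "\<phi> m + p m * (b - m) \<le> \<phi> b"
      using sub by (auto simp: subgradient_def)
    define a where "a = p b - p m"
    have a0: "0 \<le> a" using subgradient_mono[OF sub, of m b] mb by (simp add: a_def)
    \<comment> \<open>The abscissa where the tangents at \<open>m\<close> and \<open>b\<close>
      cross. If the slopes agree, the tangents coincide, and 0 is an arbitrary default multiplied by
      \<open>a = 0\<close>.\<close>
    define z where "z = (if a = 0 then 0 else (\<phi> m - p m * m - \<phi> b + p b * b) / a)"
    have diff: "max (tangent \<phi> p b x) (tangent \<phi> p m x) = tangent \<phi> p m x + a * max 0 (x - z)" for x
    proof (cases "a = 0")
      case True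
      then have "p b = p m" by (simp add: a_def)
      with bm show ?thesis using True by (simp add: tangent_def algebra_simps)
    next
      case False
      then have "a * z = \<phi> m - p m * m - \<phi> b + p b * b" by (simp add: z_def)
      then have "tangent \<phi> p b x - tangent \<phi> p m x = a * (x - z)"
        by (simp add: tangent_def algebra_simps a_def)
      moreover have "a * max 0 (x - z) = max 0 (a * (x - z))"
        using a0 by (simp add: max_mult_distrib_left)
      ultimately show ?thesis by linarith
    qed
    \<comment> \<open>Right of \<open>m\<close> the old maximum is just the tangent at
      \<open>m\<close>. Left of \<open>m\<close> the new tangent lies below, and the call vanishes
      because it already vanishes at \<open>m\<close>.\<close>
    have "max (tangent \<phi> p b x) (Q x) = Q x + a * max 0 (x - z)" for x
    proof (cases "m \<le> x")
      case True
      then show ?thesis using diff[of x] Q_right[of x] by simp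
    next
      case x: False
      have "a * max 0 (m - z) = 0"
        using diff[of m] left[of m] Q_right[of m] by simp
      then have "a * max 0 (x - z) = 0"
        using x by (auto simp: max_def split: if_splits)
      then show ?thesis using left[of x] x by simp
    qed
    then have "P (\<lambda>x. max (tangent \<phi> p b x) (Q x))" using call[OF PQ a0] by simp
    then show ?thesis unfolding step .
  qed
qed

text \<open>Countably many contact points suffice by continuity. The extra contact point 0 keeps the
  finite sets nonempty and provides one affine minorant for the whole sequence.\<close>

lemma tangents_converge:
  assumes "convex_on UNIV \<phi>" and sub: "subgradient \<phi> p" and r: "range r = \<rat>"
  shows "(\<lambda>n. Max ((\<lambda>k. tangent \<phi> p k x) ` insert 0 (r ` {..<n}))) \<longlonglongrightarrow> \<phi> x"
proof (rule LIMSEQ_I)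
  fix e :: real assume e: "e > 0"
  have cont: "continuous_on UNIV \<phi>" by (rule convex_continuous_real[OF assms(1)])
  \<comment> \<open>Reflecting \<open>x\<close> in \<open>q\<close> avoids any bound on the slope
    \<open>p q\<close>: the supporting line at \<open>q\<close>, tested at \<open>2 * q - x\<close>,
    bounds the tangent's value at \<open>x\<close> from below by this expression, which tends to
    \<open>\<phi> x\<close>.\<close>
  have "isCont (\<lambda>q. 2 * \<phi> q - \<phi> (2 * q - x)) x"
    by (intro continuous_intros continuous_on_interior[OF cont] isCont_o2[where g=\<phi>]) auto
  then obtain d where d: "d > 0"
    and d': "\<And>q. \<bar>q - x\<bar> < d \<Longrightarrow> \<bar>(2 * \<phi> q - \<phi> (2 * q - x)) - \<phi> x\<bar> < e"
    using e unfolding continuous_at_eps_delta dist_real_def by force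
  obtain q where q: "q \<in> \<rat>" "x < q" "q < x + d" using Rats_dense_in_real[of x "x + d"] d by auto
  then obtain i where i: "q = r i" using r by (metis imageE)
  have "\<phi> q + p q * ((2 * q - x) - q) \<le> \<phi> (2 * q - x)" using sub unfolding subgradient_def by blast
  then have "2 * \<phi> q - \<phi> (2 * q - x) \<le> tangent \<phi> p q x" by (simp add: tangent_def algebra_simps)
  then have close: "\<phi> x - e < tangent \<phi> p q x" using d'[of q] q by (auto simp: abs_if split: if_splits)
  have "norm (Max ((\<lambda>k. tangent \<phi> p k x) ` insert 0 (r ` {..<n})) - \<phi> x) < e" if n: "n \<ge> Suc i" for n
  proof -
    have "Max ((\<lambda>k. tangent \<phi> p k x) ` insert 0 (r ` {..<n})) \<le> \<phi> x"
      by (intro Max.boundedI) (auto intro: tangent_le[OF sub])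
    moreover have "tangent \<phi> p q x \<le> Max ((\<lambda>k. tangent \<phi> p k x) ` insert 0 (r ` {..<n}))"
      using n i by (intro Max_ge) auto
    ultimately show ?thesis using close by auto
  qed
  then show "\<exists>N. \<forall>n\<ge>N. norm (Max ((\<lambda>k. tangent \<phi> p k x) ` insert 0 (r ` {..<n})) - \<phi> x) < e"
    by blast
qed

section \<open>Potentials and the convex order\<close>

definition potential :: "real measure \<Rightarrow> real \<Rightarrow> real" where
  "potential \<mu> c = (\<integral>x. max 0 (c - x) \<partial>\<mu>)"

lemma P1_real_distribution: "\<mu> \<in> P1 \<Longrightarrow> real_distribution \<mu>"
  and P1_integrable: "\<mu> \<in> P1 \<Longrightarrow> integrable \<mu> (\<lambda>x. x)"
  by (auto simp: P1_def)

lemma integrable_put: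
  fixes X :: "'a \<Rightarrow> real"
  assumes "finite_measure M" "integrable M X"
  shows "integrable M (\<lambda>x. max 0 (c - X x))"
proof -
  interpret finite_measure M by fact
  show ?thesis using assms(2) by (intro integrable_max) auto
qed

lemma P1_integrable_put: "\<mu> \<in> P1 \<Longrightarrow> integrable \<mu> (\<lambda>x. max 0 (c - x))"
  using P1_real_distribution[of \<mu>] P1_integrable[of \<mu>]
  by (intro integrable_put) (auto simp: real_distribution_def prob_space_def)

lemma P1_integral_affine:
  assumes "\<mu> \<in> P1"
  shows "integrable \<mu> (\<lambda>x. a + b * x)" "(\<integral>x. a + b * x \<partial>\<mu>) = a + b * (\<integral>x. x \<partial>\<mu>)"
proof -
  interpret real_distribution \<mu> by (rule P1_real_distribution[OF assms])
  note i = P1_integrable[OF assms]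
  show "integrable \<mu> (\<lambda>x. a + b * x)" using i by auto
  show "(\<integral>x. a + b * x \<partial>\<mu>) = a + b * (\<integral>x. x \<partial>\<mu>)" using i by (subst Bochner_Integration.integral_add) (auto simp: prob_space[unfolded space_eq_univ])
qed

lemma convex_le_mean:
  assumes "\<eta> \<in> P1" "\<nu> \<in> P1" "\<eta> \<le>\<^sub>c \<nu>"
  shows "(\<integral>x. x \<partial>\<eta>) = (\<integral>x. x \<partial>\<nu>)"
proof -
  have le: "(\<integral>x. 0 + b * x \<partial>\<eta>) \<le> (\<integral>x. 0 + b * x \<partial>\<nu>)" for b
  proof -
    have "convex_on UNIV (\<lambda>x::real. 0 + b * x)" by (auto simp: convex_on_def algebra_simps)
    then show ?thesis
      using assms ext_integral_eq_lebesgue_integral P1_integral_affine(1)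
      unfolding convex_le_def by (metis ereal_less_eq(3))
  qed
  show ?thesis using le[of 1] le[of "-1"] by simp
qed

lemma convex_on_put: "convex_on UNIV (\<lambda>x::real. max 0 (c - x))"
proof (rule convex_onI)
  fix t x y :: real assume "0 < t" "t < 1"
  then have "(1 - t) * (c - x) \<le> (1 - t) * max 0 (c - x)" "t * (c - y) \<le> t * max 0 (c - y)"
    "0 \<le> (1 - t) * max 0 (c - x)" "0 \<le> t * max 0 (c - y)"
    by (auto intro!: mult_left_mono)
  moreover have "c - ((1 - t) *\<^sub>R x + t *\<^sub>R y) = (1 - t) * (c - x) + t * (c - y)"
    by (simp add: algebra_simps)
  ultimately show "max 0 (c - ((1 - t) *\<^sub>R x + t *\<^sub>R y)) \<le> (1 - t) * max 0 (c - x) + t * max 0 (c - y)"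
    by linarith
qed auto

lemma convex_le_potential:
  assumes "\<eta> \<in> P1" "\<nu> \<in> P1" "\<eta> \<le>\<^sub>c \<nu>"
  shows "potential \<eta> c \<le> potential \<nu> c"
  using assms convex_on_put[of c] unfolding convex_le_def potential_def
  by (metis ext_integral_eq_lebesgue_integral P1_integrable_put ereal_less_eq(3))

text \<open>The comparison holds for affine functions by equality of means and for puts by
  hypothesis, hence for all finite maxima of tangents; these increase to
  \<open>\<phi>\<close>.\<close>

lemma convex_leI:
  assumes \<eta>: "\<eta> \<in> P1" and \<nu>: "\<nu> \<in> P1" and mean: "(\<integral>x. x \<partial>\<eta>) = (\<integral>x. x \<partial>\<nu>)"
    and pot: "\<And>c. potential \<eta> c \<le> potential \<nu> c"
  shows "\<eta> \<le>\<^sub>c \<nu>"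
  unfolding convex_le_def
proof (intro allI impI)
  fix \<phi> :: "real \<Rightarrow> real" assume cvx: "convex_on UNIV \<phi>"
  obtain p where sub: "subgradient \<phi> p" using convex_imp_subgradient[OF cvx] .
  define good where "good \<psi> \<longleftrightarrow> integrable \<eta> \<psi> \<and> integrable \<nu> \<psi> \<and> (\<integral>x. \<psi> x \<partial>\<eta>) \<le> (\<integral>x. \<psi> x \<partial>\<nu>)"
    for \<psi> :: "real \<Rightarrow> real"
  have affine: "good (\<lambda>x. a + b * x)" for a b
    unfolding good_def using P1_integral_affine[OF \<eta>] P1_integral_affine[OF \<nu>] mean by simp
  have put: "good (\<lambda>x. max 0 (z - x))" for z
    unfolding good_def using P1_integrable_put[OF \<eta>] P1_integrable_put[OF \<nu>] pot[of z]
    by (simp add: potential_def)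
  have add: "good (\<lambda>x. \<psi> x + a * \<xi> x)" if "good \<psi>" "good \<xi>" "0 \<le> a" for \<psi> \<xi> a
    using that unfolding good_def by (auto intro!: add_mono mult_left_mono)
  have call: "good (\<lambda>x. \<psi> x + a * max 0 (x - z))" if "good \<psi>" "0 \<le> a" for \<psi> a z
  proof -
    \<comment> \<open>Put-call parity: a call is a put plus an affine function.\<close>
    have "(\<lambda>x. (- z + 1 * x) + 1 * max 0 (z - x)) = (\<lambda>x. max 0 (x - z))" by auto
    with add[OF affine[of "- z" 1] put[of z], of 1] have "good (\<lambda>x. max 0 (x - z))" by simp
    from add[OF that(1) this that(2)] show ?thesis .
  qed
  \<comment> \<open>Subtracting the tangent at 0 makes the approximations nonnegative, so monotone
    convergence applies even if \<open>\<phi>\<close> has infinite integral. Equal means give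
    \<open>t\<close> the same integral under both laws.\<close>
  define t where "t = tangent \<phi> p 0"
  have t_affine: "t = (\<lambda>x. \<phi> 0 + p 0 * x)" by (auto simp: t_def tangent_def)
  define r :: "nat \<Rightarrow> real" where "r = from_nat_into \<rat>"
  have r: "range r = \<rat>" unfolding r_def by (intro range_from_nat_into) (auto intro: countable_rat)
  define \<psi> where "\<psi> n x = Max ((\<lambda>k. tangent \<phi> p k x) ` insert 0 (r ` {..<n}))" for n x
  have good\<psi>: "good (\<psi> n)" for n
    using Max_tangent_induct[OF sub, of "insert 0 (r ` {..<n})" good] affine call
    unfolding \<psi>_def[abs_def] by auto
  have t_le: "t x \<le> \<psi> n x" for n x unfolding \<psi>_def t_def by (intro Max_ge) auto
  have \<psi>_le: "\<psi> n x \<le> \<phi> x" for n x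
    unfolding \<psi>_def by (intro Max.boundedI) (auto intro: tangent_le[OF sub])
  have lim: "(\<lambda>n. \<psi> n x) \<longlonglongrightarrow> \<phi> x" for x unfolding \<psi>_def by (rule tangents_converge[OF cvx sub r])
  have mono: "\<psi> n x \<le> \<psi> n' x" if "n \<le> n'" for n n' x
    unfolding \<psi>_def using that by (intro Max_mono) auto
  have meas: "\<phi> \<in> borel_measurable borel" by (rule convex_measurable[OF cvx])
  have nn: "(\<lambda>n. \<integral>\<^sup>+x. ennreal (\<psi> n x - t x) \<partial>M) \<longlonglongrightarrow> (\<integral>\<^sup>+x. ennreal (\<phi> x - t x) \<partial>M)"
    if "integrable M t" "\<And>n. integrable M (\<psi> n)" for M
  proof (rule nn_integral_LIMSEQ)
    show "incseq (\<lambda>n x. ennreal (\<psi> n x - t x))"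
      by (auto simp: incseq_def le_fun_def intro!: ennreal_leI diff_mono mono)
    show "(\<lambda>x. ennreal (\<psi> n x - t x)) \<in> borel_measurable M" for n
      using that(1) that(2)[of n] by measurable
    show "(\<lambda>n. ennreal (\<psi> n x - t x)) \<longlonglongrightarrow> ennreal (\<phi> x - t x)" for x
      by (intro tendsto_ennrealI tendsto_intros lim)
  qed
  have int_t: "integrable \<eta> t" "integrable \<nu> t" "(\<integral>x. t x \<partial>\<eta>) = (\<integral>x. t x \<partial>\<nu>)"
    unfolding t_affine using P1_integral_affine[OF \<eta>] P1_integral_affine[OF \<nu>] mean by auto
  have int_\<psi>: "integrable \<eta> (\<psi> n)" "integrable \<nu> (\<psi> n)" "(\<integral>x. \<psi> n x \<partial>\<eta>) \<le> (\<integral>x. \<psi> n x \<partial>\<nu>)" for n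
    using good\<psi>[of n] by (auto simp: good_def)
  have "(\<integral>\<^sup>+x. ennreal (\<psi> n x - t x) \<partial>\<eta>) \<le> (\<integral>\<^sup>+x. ennreal (\<psi> n x - t x) \<partial>\<nu>)" for n
    using int_t int_\<psi>[of n] t_le
    by (subst (1 2) nn_integral_eq_integral) (auto intro!: ennreal_leI)
  then have main: "(\<integral>\<^sup>+x. ennreal (\<phi> x - t x) \<partial>\<eta>) \<le> (\<integral>\<^sup>+x. ennreal (\<phi> x - t x) \<partial>\<nu>)"
    by (intro LIMSEQ_le[OF nn nn]) (use int_t int_\<psi> in auto)
  have "ext_integral M \<phi> = enn2ereal (\<integral>\<^sup>+x. ennreal (\<phi> x - t x) \<partial>M) + ereal (\<integral>x. t x \<partial>M)"
    if "sets M = sets borel" "integrable M t" for M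
  proof -
    have "(\<lambda>x. \<phi> x - t x) \<in> borel_measurable M"
      using meas that by (auto simp: measurable_cong_sets[OF that(1) refl])
    from ext_integral_nonneg_add[OF this _ that(2)] show ?thesis
      using order_trans[OF t_le \<psi>_le] by auto
  qed
  from this[of \<eta>] this[of \<nu>] show "ext_integral \<eta> \<phi> \<le> ext_integral \<nu> \<phi>"
    using main int_t P1_real_distribution[OF \<eta>] P1_real_distribution[OF \<nu>]
    by (auto simp: real_distribution_def real_distribution_axioms_def less_eq_ennreal.rep_eq intro!: add_right_mono)
qed

lemma potential_nonneg: "0 \<le> potential \<mu> c"
  unfolding potential_def by (intro Bochner_Integration.integral_nonneg) auto

lemma potential_ge:
  assumes "\<mu> \<in> P1"
  shows "c - (\<integral>x. x \<partial>\<mu>) \<le> potential \<mu> c"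
proof -
  have "(\<integral>x. c + - 1 * x \<partial>\<mu>) \<le> potential \<mu> c"
    unfolding potential_def
    by (intro integral_mono P1_integrable_put[OF assms] P1_integral_affine(1)[OF assms]) auto
  then show ?thesis unfolding P1_integral_affine(2)[OF assms] by simp
qed

text \<open>For fixed \<open>x\<close>, the indicator of \<open>x \<le> c\<close> is a supporting
  slope at \<open>c\<close> of the put payoff as a function of the strike; integrating it yields the
  distribution function.\<close>

lemma potential_subgradient:
  assumes "\<mu> \<in> P1"
  shows "potential \<mu> c + (c' - c) * cdf \<mu> c \<le> potential \<mu> c'"
proof -
  interpret real_distribution \<mu> by (rule P1_real_distribution[OF assms])
  note [simp] = P1_integrable_put[OF assms]
  have ind: "integrable \<mu> (\<lambda>x. (c' - c) * indicator {..c} x)"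
    by (intro integrable_mult_right integrable_real_indicator) (auto simp: less_top[symmetric])
  have "potential \<mu> c + (c' - c) * cdf \<mu> c
      = (\<integral>x. max 0 (c - x) + (c' - c) * indicator {..c} x \<partial>\<mu>)"
    using ind by (simp add: potential_def cdf_def)
  also have "\<dots> \<le> potential \<mu> c'"
    unfolding potential_def
    by (intro integral_mono Bochner_Integration.integrable_add ind) (auto simp: indicator_def)
  finally show ?thesis .
qed

lemma potential_mono:
  assumes "\<mu> \<in> P1" "c \<le> c'"
  shows "potential \<mu> c \<le> potential \<mu> c'"
  unfolding potential_def using assms by (intro integral_mono P1_integrable_put) auto

text \<open>Convexity in the form of increasing differences, as the comparison of maximizers will
  use it.\<close>

lemma potential_increment_mono:
  assumes "\<mu> \<in> P1" "a \<le> b" "0 \<le> d"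
  shows "potential \<mu> (a + d) - potential \<mu> a \<le> potential \<mu> (b + d) - potential \<mu> b"
proof -
  note [simp] = P1_integrable_put[OF assms(1)]
  have "(\<integral>x. max 0 (a + d - x) + max 0 (b - x) \<partial>\<mu>) \<le> (\<integral>x. max 0 (b + d - x) + max 0 (a - x) \<partial>\<mu>)"
    using assms(2,3) by (intro integral_mono) auto
  then show ?thesis by (simp add: potential_def)
qed

lemma potential_le_add:
  assumes "\<mu> \<in> P1" "c \<le> c'"
  shows "potential \<mu> c' \<le> potential \<mu> c + (c' - c)"
proof -
  interpret real_distribution \<mu> by (rule P1_real_distribution[OF assms(1)])
  have "potential \<mu> c' \<le> (\<integral>x. max 0 (c - x) + (c' - c) \<partial>\<mu>)"
    unfolding potential_def using assms P1_integrable_put[OF assms(1)]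
    by (intro integral_mono) auto
  also have "\<dots> = potential \<mu> c + (c' - c)"
    using P1_integrable_put[OF assms(1)] by (simp add: potential_def prob_space[unfolded space_eq_univ])
  finally show ?thesis .
qed

lemma potential_at_bot:
  assumes "\<mu> \<in> P1"
  shows "(potential \<mu> \<longlongrightarrow> 0) at_bot"
proof -
  interpret real_distribution \<mu> by (rule P1_real_distribution[OF assms])
  have "((\<lambda>c. \<integral>x. max 0 (- c - x) \<partial>\<mu>) \<longlongrightarrow> (\<integral>x. 0 \<partial>\<mu>)) at_top"
  proof (rule integral_dominated_convergence_at_top[where w="\<lambda>x. \<bar>x\<bar>"])
    show "integrable \<mu> (\<lambda>x. \<bar>x\<bar>)" using P1_integrable[OF assms] by auto
    show "\<forall>\<^sub>F c in at_top. AE x in \<mu>. norm (max 0 (- c - x)) \<le> \<bar>x\<bar>"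
      using eventually_ge_at_top[of 0] by eventually_elim auto
    show "AE x in \<mu>. ((\<lambda>c. max 0 (- c - x)) \<longlongrightarrow> 0) at_top"
    proof (rule AE_I2)
      fix x :: real
      have "\<forall>\<^sub>F c in at_top. max 0 (- c - x) = 0"
        using eventually_ge_at_top[of "-x"] by eventually_elim auto
      then show "((\<lambda>c. max 0 (- c - x)) \<longlongrightarrow> 0) at_top" by (rule tendsto_eventually)
    qed
  qed auto
  then show ?thesis unfolding filterlim_at_bot_mirror potential_def by simp
qed

text \<open>By put-call parity the left side is a call price minus the mean, and call prices vanish
  as the strike grows.\<close>

lemma potential_at_top:
  assumes "\<mu> \<in> P1"
  shows "((\<lambda>c. potential \<mu> c - c) \<longlongrightarrow> - (\<integral>x. x \<partial>\<mu>)) at_top"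
proof -
  interpret real_distribution \<mu> by (rule P1_real_distribution[OF assms])
  have "((\<lambda>c. \<integral>x. max 0 (x - c) \<partial>\<mu>) \<longlongrightarrow> (\<integral>x. 0 \<partial>\<mu>)) at_top"
  proof (rule integral_dominated_convergence_at_top[where w="\<lambda>x. \<bar>x\<bar>"])
    show "integrable \<mu> (\<lambda>x. \<bar>x\<bar>)" using P1_integrable[OF assms] by auto
    show "\<forall>\<^sub>F c in at_top. AE x in \<mu>. norm (max 0 (x - c)) \<le> \<bar>x\<bar>"
      using eventually_ge_at_top[of 0] by eventually_elim auto
    show "AE x in \<mu>. ((\<lambda>c. max 0 (x - c)) \<longlongrightarrow> 0) at_top"
    proof (rule AE_I2)
      fix x :: real
      have "\<forall>\<^sub>F c in at_top. max 0 (x - c) = 0"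
        using eventually_ge_at_top[of x] by eventually_elim auto
      then show "((\<lambda>c. max 0 (x - c)) \<longlongrightarrow> 0) at_top" by (rule tendsto_eventually)
    qed
  qed auto
  then have "((\<lambda>c. (\<integral>x. max 0 (x - c) \<partial>\<mu>) - (\<integral>x. x \<partial>\<mu>)) \<longlongrightarrow> 0 - (\<integral>x. x \<partial>\<mu>)) at_top"
    by (intro tendsto_intros) simp
  moreover have "(\<integral>x. max 0 (x - c) \<partial>\<mu>) - (\<integral>x. x \<partial>\<mu>) = potential \<mu> c - c" for c
  proof -
    have "(\<lambda>x. max 0 (x - c)) = (\<lambda>x. max 0 (c - x) + (- c + 1 * x))" by auto
    then have "(\<integral>x. max 0 (x - c) \<partial>\<mu>) = potential \<mu> c + (\<integral>x. - c + 1 * x \<partial>\<mu>)"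
      unfolding potential_def
      using P1_integrable_put[OF assms] P1_integral_affine(1)[OF assms, of "-c" 1]
      by (simp only: Bochner_Integration.integral_add)
    then show ?thesis unfolding P1_integral_affine(2)[OF assms] by simp
  qed
  ultimately show ?thesis by simp
qed

lemma cdf_le_from_right:
  assumes "real_distribution \<mu>" "real_distribution \<nu>"
    and "\<And>h. 0 < h \<Longrightarrow> cdf \<mu> c \<le> cdf \<nu> (c + h)"
  shows "cdf \<mu> c \<le> cdf \<nu> c"
proof -
  interpret \<nu>: real_distribution \<nu> by fact
  have "(cdf \<nu> \<longlongrightarrow> cdf \<nu> c) (at_right c)"
    using \<nu>.cdf_is_right_cont[of c] by (simp add: continuous_within)
  moreover have "\<forall>\<^sub>F x in at_right c. cdf \<mu> c \<le> cdf \<nu> x"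
  proof (rule eventually_at_rightI)
    show "cdf \<mu> c \<le> cdf \<nu> x" if "x \<in> {c<..<c + 1}" for x
      using assms(3)[of "x - c"] that by simp
  qed auto
  ultimately show ?thesis by (intro tendsto_lowerbound) auto
qed

text \<open>Both distribution functions are supporting slopes of one convex function, so either one
  at \<open>c\<close> is at most the other at \<open>c + h\<close>; right continuity removes
  \<open>h\<close>.\<close>

lemma potential_inject:
  assumes "\<mu> \<in> P1" "\<nu> \<in> P1" "\<And>c. potential \<mu> c = potential \<nu> c"
  shows "\<mu> = \<nu>"
proof -
  have le: "cdf \<alpha> c \<le> cdf \<beta> c"
    if "\<alpha> \<in> P1" "\<beta> \<in> P1" "\<And>c. potential \<alpha> c = potential \<beta> c" for \<alpha> \<beta> c
  proof (rule cdf_le_from_right)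
    fix h :: real assume h: "0 < h"
    have "h * cdf \<alpha> c \<le> h * cdf \<beta> (c + h)"
      using potential_subgradient[OF that(1), of c "c + h"]
        potential_subgradient[OF that(2), of "c + h" c] that(3) by simp
    then show "cdf \<alpha> c \<le> cdf \<beta> (c + h)" using h by simp
  qed (use that P1_real_distribution in auto)
  show ?thesis
    using assms by (intro cdf_unique P1_real_distribution ext antisym le) auto
qed

lemma P1_distr:
  assumes "prob_space M" "integrable M f"
  shows "distr M borel f \<in> P1"
proof -
  interpret prob_space M by fact
  show ?thesis using assms(2) unfolding P1_def by (auto simp: integrable_distr_eq)
qed

lemma potential_distr:
  assumes "f \<in> borel_measurable M"
  shows "potential (distr M borel f) c = (\<integral>x. max 0 (c - f x) \<partial>M)"
  unfolding potential_def using assms by (simp add: integral_distr)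

lemma mean_distr:
  fixes f :: "'a \<Rightarrow> real"
  assumes "f \<in> borel_measurable M"
  shows "(\<integral>x. x \<partial>distr M borel f) = (\<integral>x. f x \<partial>M)"
  using assms by (simp add: integral_distr)

lemma potential_distr_add_le:
  assumes M: "prob_space M" and X: "integrable M X" and Y: "integrable M Y"
  shows "potential (distr M borel (\<lambda>\<omega>. X \<omega> + Y \<omega>)) (a + b)
    \<le> potential (distr M borel X) a + potential (distr M borel Y) b"
proof -
  interpret prob_space M by fact
  note i = integrable_put[OF finite_measure_axioms]
  have "(\<integral>\<omega>. max 0 (a + b - (X \<omega> + Y \<omega>)) \<partial>M) \<le> (\<integral>\<omega>. max 0 (a - X \<omega>) + max 0 (b - Y \<omega>) \<partial>M)"
    using X Y by (intro integral_mono i Bochner_Integration.integrable_add) auto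
  also have "\<dots> = (\<integral>\<omega>. max 0 (a - X \<omega>) \<partial>M) + (\<integral>\<omega>. max 0 (b - Y \<omega>) \<partial>M)"
    using X Y by (intro Bochner_Integration.integral_add i)
  finally show ?thesis using X Y by (simp add: potential_distr)
qed

section \<open>Increasing contractions\<close>

text \<open>Amounts to nondecreasing and 1-Lipschitz, written so that the symmetry between
  \<open>S\<close> and its residual \<open>x - S x\<close> is visible.\<close>

definition increasing_contraction :: "(real \<Rightarrow> real) \<Rightarrow> bool" where
  "increasing_contraction S \<longleftrightarrow> mono S \<and> mono (\<lambda>x. x - S x)"

lemma increasing_contraction_iff:
  "increasing_contraction S \<longleftrightarrow> mono S \<and> 1-lipschitz_on UNIV S"
proof
  assume *: "increasing_contraction S"
  have "\<bar>S x - S y\<bar> \<le> \<bar>x - y\<bar>" for x y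
  proof (cases "x \<le> y")
    case True
    then have "S x \<le> S y" "x - S x \<le> y - S y"
      using * by (auto simp: increasing_contraction_def mono_def)
    then show ?thesis by linarith
  next
    case False
    then have "S y \<le> S x" "y - S y \<le> x - S x"
      using * by (auto simp: increasing_contraction_def mono_def)
    then show ?thesis by linarith
  qed
  then show "mono S \<and> 1-lipschitz_on UNIV S"
    using * by (auto simp: increasing_contraction_def intro!: lipschitz_onI simp: dist_real_def)
next
  assume *: "mono S \<and> 1-lipschitz_on UNIV S"
  have "x - S x \<le> y - S y" if "x \<le> y" for x y
  proof -
    have "dist (S x) (S y) \<le> 1 * dist x y" using * by (intro lipschitz_onD) auto
    then show ?thesis using that by (simp add: dist_real_def)
  qed
  then show "increasing_contraction S" using * by (auto simp: increasing_contraction_def mono_def)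
qed

lemma increasing_contraction_residual:
  "increasing_contraction S \<Longrightarrow> increasing_contraction (\<lambda>x. x - S x)"
  by (simp add: increasing_contraction_def)

lemma increasing_contraction_continuous:
  "increasing_contraction S \<Longrightarrow> continuous_on UNIV S"
  unfolding increasing_contraction_iff by (auto intro: lipschitz_on_continuous_on)

lemma increasing_contraction_measurable:
  "increasing_contraction S \<Longrightarrow> S \<in> borel_measurable borel"
  by (intro borel_measurable_continuous_onI increasing_contraction_continuous)

lemma increasing_contraction_abs:
  assumes "increasing_contraction S"
  shows "\<bar>S x\<bar> \<le> \<bar>S 0\<bar> + \<bar>x\<bar>"
proof -
  have "dist (S x) (S 0) \<le> 1 * dist x 0"
    using assms unfolding increasing_contraction_iff by (intro lipschitz_onD) auto
  then show ?thesis by (auto simp: dist_real_def)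
qed

lemma increasing_contraction_integrable:
  assumes "\<mu> \<in> P1" "increasing_contraction S"
  shows "integrable \<mu> S"
proof -
  interpret real_distribution \<mu> by (rule P1_real_distribution[OF assms(1)])
  show ?thesis
  proof (rule Bochner_Integration.integrable_bound)
    show "integrable \<mu> (\<lambda>x. \<bar>S 0\<bar> + \<bar>x\<bar>)" using P1_integrable[OF assms(1)] by auto
    show "S \<in> borel_measurable \<mu>" using increasing_contraction_measurable[OF assms(2)] by simp
    show "AE x in \<mu>. norm (S x) \<le> norm (\<bar>S 0\<bar> + \<bar>x\<bar>)"
      using increasing_contraction_abs[OF assms(2)] by auto
  qed
qed

lemma pushforward_P1:
  assumes "\<mu> \<in> P1" "increasing_contraction S"
  shows "pushforward S \<mu> \<in> P1"
  unfolding pushforward_def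
  using P1_real_distribution[OF assms(1)] increasing_contraction_integrable[OF assms]
  by (intro P1_distr) (auto simp: real_distribution_def)

lemma potential_pushforward:
  assumes "\<mu> \<in> P1" "increasing_contraction S"
  shows "potential (pushforward S \<mu>) c = (\<integral>x. max 0 (c - S x) \<partial>\<mu>)"
  using increasing_contraction_integrable[OF assms]
  by (simp add: pushforward_def potential_distr)

lemma mean_pushforward:
  assumes "\<mu> \<in> P1" "increasing_contraction S"
  shows "(\<integral>x. x \<partial>pushforward S \<mu>) = (\<integral>x. S x \<partial>\<mu>)"
  using increasing_contraction_integrable[OF assms]
  by (simp add: pushforward_def mean_distr)

lemma potential_split_le:
  assumes "\<mu> \<in> P1" "increasing_contraction S"
  shows "potential \<mu> (y + c) \<le> potential (pushforward S \<mu>) y + potential (pushforward (\<lambda>x. x - S x) \<mu>) c"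
proof -
  interpret real_distribution \<mu> by (rule P1_real_distribution[OF assms(1)])
  have "distr \<mu> borel (\<lambda>x. S x + (x - S x)) = \<mu>" by (simp add: distr_id2)
  then show ?thesis
    using potential_distr_add_le[OF prob_space_axioms increasing_contraction_integrable[OF assms]
        increasing_contraction_integrable[OF assms(1) increasing_contraction_residual[OF assms(2)]], of y c]
    by (simp add: pushforward_def)
qed

text \<open>Equality holds at matching points because \<open>S x0 - S x\<close> and the corresponding difference of
  residuals always have the same sign.\<close>

lemma potential_split_eq:
  assumes "\<mu> \<in> P1" "increasing_contraction S"
  shows "potential \<mu> x0
    = potential (pushforward S \<mu>) (S x0) + potential (pushforward (\<lambda>x. x - S x) \<mu>) (x0 - S x0)"
proof -
  interpret real_distribution \<mu> by (rule P1_real_distribution[OF assms(1)])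
  note res = increasing_contraction_residual[OF assms(2)]
  note i = integrable_put[OF finite_measure_axioms]
  have "max 0 (x0 - x) = max 0 (S x0 - S x) + max 0 ((x0 - S x0) - (x - S x))" for x
  proof (cases "x \<le> x0")
    case True
    then have "S x \<le> S x0" "x - S x \<le> x0 - S x0"
      using assms(2) by (auto simp: increasing_contraction_def mono_def)
    then show ?thesis by linarith
  next
    case False
    then have "S x0 \<le> S x" "x0 - S x0 \<le> x - S x"
      using assms(2) by (auto simp: increasing_contraction_def mono_def)
    then show ?thesis by linarith
  qed
  then have "potential \<mu> x0 = (\<integral>x. max 0 (S x0 - S x) + max 0 ((x0 - S x0) - (x - S x)) \<partial>\<mu>)"
    by (simp add: potential_def)
  also have "\<dots> = (\<integral>x. max 0 (S x0 - S x) \<partial>\<mu>) + (\<integral>x. max 0 ((x0 - S x0) - (x - S x)) \<partial>\<mu>)"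
    by (intro Bochner_Integration.integral_add i increasing_contraction_integrable[OF assms]
        increasing_contraction_integrable[OF assms(1) res])
  finally show ?thesis by (simp add: potential_pushforward[OF assms] potential_pushforward[OF assms(1) res])
qed

text \<open>Outside the closure of the range of \<open>S\<close> the potential coincides with that of the Dirac mass at
  the mean, so a comparison in convex order is only a matter of the values taken by \<open>S\<close>.\<close>

lemma pushforward_convex_leI:
  assumes \<mu>: "\<mu> \<in> P1" and S: "increasing_contraction S" and \<nu>: "\<nu> \<in> P1"
    and mean: "(\<integral>x. S x \<partial>\<mu>) = (\<integral>x. x \<partial>\<nu>)"
    and le: "\<And>x. potential (pushforward S \<mu>) (S x) \<le> potential \<nu> (S x)"
  shows "pushforward S \<mu> \<le>\<^sub>c \<nu>"
proof (rule convex_leI[OF pushforward_P1[OF \<mu> S] \<nu>])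
  interpret real_distribution \<mu> by (rule P1_real_distribution[OF \<mu>])
  show "(\<integral>x. x \<partial>pushforward S \<mu>) = (\<integral>x. x \<partial>\<nu>)" by (simp add: mean_pushforward[OF \<mu> S] mean)
  fix y
  note pot = potential_pushforward[OF \<mu> S, of y]
  \<comment> \<open>The range of \<open>S\<close> is an interval by continuity, so a value that is
    not taken lies on one side of it.\<close>
  consider "\<exists>x. S x = y" | "\<forall>x. y \<le> S x" | "\<forall>x. S x \<le> y"
  proof -
    have "\<exists>x. S x = y" if "S a < y" "y < S b" for a b
    proof -
      have "connected (range S)"
        using increasing_contraction_continuous[OF S] by (intro connected_continuous_image) auto
      then have "{S a..S b} \<subseteq> range S" by (intro connected_contains_Icc) auto
      then have "y \<in> range S" using that by auto
      then show ?thesis by blast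
    qed
    then show ?thesis using that by (meson not_le)
  qed
  then show "potential (pushforward S \<mu>) y \<le> potential \<nu> y"
  proof cases
    case 1
    then show ?thesis using le by blast
  next
    case 2
    then have "potential (pushforward S \<mu>) y = 0" unfolding pot by (simp add: max_absorb1)
    then show ?thesis by (simp add: potential_nonneg)
  next
    case 3
    then have "potential (pushforward S \<mu>) y = (\<integral>x. y - S x \<partial>\<mu>)" unfolding pot by (simp add: max_absorb2)
    also have "\<dots> = y - (\<integral>x. x \<partial>\<nu>)"
      using increasing_contraction_integrable[OF \<mu> S] by (simp add: mean prob_space[unfolded space_eq_univ])
    also have "\<dots> \<le> potential \<nu> y" by (rule potential_ge[OF \<nu>])
    finally show ?thesis .
  qed
qed

section \<open>The maximal map\<close>

locale transport_pair =
  fixes \<mu> \<nu> :: "real measure"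
  assumes \<mu>: "\<mu> \<in> P1" and \<nu>: "\<nu> \<in> P1"
begin

sublocale \<mu>: real_distribution \<mu> by (rule P1_real_distribution[OF \<mu>])

section \<open>The function \<open>R\<close> and its elementary bounds\<close>

text \<open>The substitution \<open>x = y + c\<close> in the supremum places the maximizers in the
  space of \<open>\<mu>\<close>, where the map has to be evaluated.\<close>

definition gap :: "real \<Rightarrow> real \<Rightarrow> real" where
  "gap c x = potential \<mu> x - potential \<nu> (x - c)"

definition R :: "real \<Rightarrow> real" where
  "R c = (SUP x. gap c x)"

abbreviation "m\<^sub>\<mu> \<equiv> \<integral>x. x \<partial>\<mu>"
abbreviation "m\<^sub>\<nu> \<equiv> \<integral>x. x \<partial>\<nu>"

text \<open>The potential of \<open>\<nu>\<close> dominates that of the Dirac mass at its mean. This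
  keeps the supremum finite, and the bound is sharp enough to give the limits of \<open>R\<close> at
  both ends.\<close>

lemma gap_le_potential: "gap c x \<le> potential \<mu> (c + m\<^sub>\<nu>)"
proof (cases "x \<le> c + m\<^sub>\<nu>")
  case True
  then show ?thesis
    using potential_mono[OF \<mu> True] potential_nonneg[of \<nu> "x - c"] by (simp add: gap_def)
next
  case False
  then show ?thesis
    using potential_le_add[OF \<mu>, of "c + m\<^sub>\<nu>" x] potential_ge[OF \<nu>, of "x - c"] by (simp add: gap_def)
qed

lemma bdd_above_gap: "bdd_above (range (gap c))"
  by (rule bdd_aboveI2) (rule gap_le_potential)

lemma gap_le_R: "gap c x \<le> R c"
  unfolding R_def by (intro cSUP_upper bdd_above_gap) auto

lemma R_le_potential: "R c \<le> potential \<mu> (c + m\<^sub>\<nu>)"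
  unfolding R_def by (intro cSUP_least gap_le_potential) auto

lemma R_approx:
  assumes "e > 0"
  obtains x where "R c - e < gap c x"
  using less_cSUP_iff[OF _ bdd_above_gap, of "R c - e" c] assms by (auto simp: R_def)

lemma R_le_iff: "R c \<le> z \<longleftrightarrow> (\<forall>x. gap c x \<le> z)"
  unfolding R_def by (subst cSUP_le_iff[OF _ bdd_above_gap]) auto

lemma gap_shift_c:
  assumes "c \<le> c'"
  shows "gap c x \<le> gap c' x" "gap c' x \<le> gap c x + (c' - c)"
  using potential_mono[OF \<nu>, of "x - c'" "x - c"] potential_le_add[OF \<nu>, of "x - c'" "x - c"] assms
  by (auto simp: gap_def)

lemma R_shift:
  assumes "c \<le> c'"
  shows "R c \<le> R c'" "R c' \<le> R c + (c' - c)"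
  unfolding R_le_iff using gap_shift_c[OF assms] gap_le_R by (meson order_trans add_right_mono)+

lemma R_nonneg: "0 \<le> R c"
proof (rule field_le_epsilon)
  fix e :: real assume "e > 0"
  then have "\<forall>\<^sub>F y in at_bot. potential \<nu> y < e"
    using order_tendstoD(2)[OF potential_at_bot[OF \<nu>]] by simp
  then obtain y where "potential \<nu> y < e" by (auto simp: eventually_at_bot_linorder)
  then show "0 \<le> R c + e"
    using gap_le_R[of c "y + c"] potential_nonneg[of \<mu> "y + c"] by (simp add: gap_def)
qed

text \<open>As its argument grows, \<open>gap c\<close> tends to \<open>c\<close> minus the mean of
  \<open>\<mu>\<close> plus the mean of \<open>\<nu>\<close>. The witness lies beyond a prescribed
  \<open>x\<close> because \<open>reaches\<close> asks for such points.\<close>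

lemma gap_large:
  assumes "z < c - m\<^sub>\<mu> + m\<^sub>\<nu>"
  obtains x' where "x \<le> x'" "z < gap c x'"
proof -
  have "\<forall>\<^sub>F y in at_top. potential \<nu> y - y < c - m\<^sub>\<mu> - z"
    using order_tendstoD(2)[OF potential_at_top[OF \<nu>]] assms by simp
  moreover have "\<forall>\<^sub>F y in at_top. x - c \<le> y" by (rule eventually_ge_at_top)
  ultimately have "\<forall>\<^sub>F y in at_top. potential \<nu> y - y < c - m\<^sub>\<mu> - z \<and> x - c \<le> y"
    by eventually_elim auto
  then obtain y where "potential \<nu> y - y < c - m\<^sub>\<mu> - z" "x - c \<le> y"
    by (auto simp: eventually_at_top_linorder)
  then show ?thesis
    using potential_ge[OF \<mu>, of "y + c"] by (intro that[of "y + c"]) (auto simp: gap_def)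
qed

lemma R_ge_mean: "c - m\<^sub>\<mu> + m\<^sub>\<nu> \<le> R c"
proof (rule dense_le)
  fix z assume "z < c - m\<^sub>\<mu> + m\<^sub>\<nu>"
  then obtain x' where "z < gap c x'" by (rule gap_large[where x=0])
  then show "z \<le> R c" using gap_le_R[of c x'] by simp
qed

text \<open>The set of \<open>x\<close> satisfying the next predicate is the down-closure of the set of maximizers of
  \<open>gap c\<close>, where \<open>+\<infinity>\<close> counts as a maximizer if the supremum is approached there.\<close>

definition reaches :: "real \<Rightarrow> real \<Rightarrow> bool" where
  "reaches c x \<longleftrightarrow> (\<forall>e>0. \<exists>x'\<ge>x. R c - e < gap c x')"

lemma reachesD: "reaches c x \<Longrightarrow> e > 0 \<Longrightarrow> \<exists>x'\<ge>x. R c - e < gap c x'"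
  by (simp add: reaches_def)

text \<open>Topkis' comparative statics: the convexity of \<open>potential \<nu>\<close> gives \<open>gap\<close> increasing differences
  in \<open>(c, x)\<close>, and that of \<open>potential \<mu>\<close> gives increasing differences in \<open>(c, x - c)\<close>.\<close>

lemma reaches_mono_c:
  assumes "reaches c x" "c \<le> c'"
  shows "reaches c' x"
  unfolding reaches_def
proof (intro allI impI)
  fix e :: real assume e: "e > 0"
  then obtain x1 where x1: "R c' - e / 2 < gap c' x1" using R_approx[of "e / 2" c'] by auto
  show "\<exists>x'\<ge>x. R c' - e < gap c' x'"
  proof (cases "x \<le> x1")
    case True
    then show ?thesis using x1 e by (intro exI[of _ x1]) auto
  next
    case False
    obtain x2 where x2: "x \<le> x2" "R c - e / 2 < gap c x2"
      using reachesD[OF assms(1), of "e / 2"] e by auto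
    \<comment> \<open>\<open>x1\<close> is nearly optimal for \<open>c'\<close> and
      \<open>x2\<close> for \<open>c\<close>, with \<open>x1 < x2\<close>. Exchanging the two points
      loses nothing, so \<open>x2\<close> is nearly optimal for \<open>c'\<close>, with the two
      errors \<open>e / 2\<close> added.\<close>
    have "potential \<nu> (x1 - c' + (c' - c)) - potential \<nu> (x1 - c')
        \<le> potential \<nu> (x2 - c' + (c' - c)) - potential \<nu> (x2 - c')"
      using assms(2) False x2 by (intro potential_increment_mono[OF \<nu>]) auto
    then have "gap c' x1 + gap c x2 \<le> gap c' x2 + gap c x1" by (simp add: gap_def)
    then show ?thesis using x2 x1 gap_le_R[of c x1] by (intro exI[of _ x2]) auto
  qed
qed

lemma reaches_mono_shift:
  assumes "reaches c x" "0 \<le> d"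
  shows "reaches (c + d) (x + d)"
  unfolding reaches_def
proof (intro allI impI)
  fix e :: real assume e: "e > 0"
  then obtain x1 where x1: "R (c + d) - e / 2 < gap (c + d) x1" using R_approx[of "e / 2" "c + d"] by auto
  show "\<exists>x'\<ge>x + d. R (c + d) - e < gap (c + d) x'"
  proof (cases "x + d \<le> x1")
    case True
    then show ?thesis using x1 e by (intro exI[of _ x1]) auto
  next
    case False
    obtain x2 where x2: "x \<le> x2" "R c - e / 2 < gap c x2"
      using reachesD[OF assms(1), of "e / 2"] e by auto
    \<comment> \<open>The same exchange with \<open>x1\<close> moved back and \<open>x2\<close>
      moved forward by \<open>d\<close>: the terms in \<open>\<nu>\<close> cancel and only convexity
      of the potential of \<open>\<mu>\<close> remains.\<close>
    have "potential \<mu> (x1 - d + d) - potential \<mu> (x1 - d) \<le> potential \<mu> (x2 + d) - potential \<mu> x2"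
      using assms(2) False x2 by (intro potential_increment_mono[OF \<mu>]) auto
    then have "gap (c + d) x1 + gap c x2 \<le> gap (c + d) (x2 + d) + gap c (x1 - d)"
      by (simp add: gap_def algebra_simps)
    then show ?thesis
      using x2 x1 gap_le_R[of c "x1 - d"] by (intro exI[of _ "x2 + d"]) auto
  qed
qed

lemma reaches_antimono: "reaches c x \<Longrightarrow> x' \<le> x \<Longrightarrow> reaches c x'"
  unfolding reaches_def by (meson order_trans)

lemma not_reaches_obtain:
  obtains c where "\<not> reaches c x"
proof
  \<comment> \<open>Chosen so that \<open>gap c\<close> is at most -1 everywhere right of
    \<open>x\<close>, whereas \<open>R c\<close> is nonnegative.\<close>
  define c where "c = x - potential \<mu> x - m\<^sub>\<nu> - 1"
  have "gap c x' \<le> R c - 1" if "x \<le> x'" for x'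
    using potential_le_add[OF \<mu> that] potential_ge[OF \<nu>, of "x' - c"] R_nonneg[of c]
    by (simp add: gap_def c_def)
  then show "\<not> reaches c x" unfolding reaches_def by (auto intro!: exI[of _ 1] simp: not_less)
qed

lemma reaches_obtain:
  obtains c where "reaches c x"
proof
  \<comment> \<open>Chosen so that the limit of \<open>gap c\<close> at infinity is
    \<open>potential \<mu> x + 1\<close>, while left of \<open>x\<close> the gap never exceeds
    \<open>potential \<mu> x\<close>.\<close>
  define c where "c = potential \<mu> x + m\<^sub>\<mu> - m\<^sub>\<nu> + 1"
  show "reaches c x"
    unfolding reaches_def
  proof (intro allI impI)
    fix e :: real assume "e > 0"
    then obtain x1 where x1: "R c - e < gap c x1" using R_approx by blast
    obtain x2 where x2: "x \<le> x2" "potential \<mu> x < gap c x2"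
      using gap_large[of "potential \<mu> x" c x] by (auto simp: c_def)
    show "\<exists>x'\<ge>x. R c - e < gap c x'"
    proof (cases "x \<le> x1")
      case False
      then have "gap c x1 \<le> potential \<mu> x"
        using potential_mono[OF \<mu>, of x1 x] potential_nonneg[of \<nu> "x1 - c"] by (simp add: gap_def)
      then show ?thesis using x1 x2 by (intro exI[of _ x2]) auto
    qed (use x1 in auto)
  qed
qed

section \<open>The residual map as a generalized inverse\<close>

definition residual :: "real \<Rightarrow> real" where
  "residual x = Inf {c. reaches c x}"

lemma bdd_below_reaches: "bdd_below {c. reaches c x}"
proof -
  obtain c0 where "\<not> reaches c0 x" by (rule not_reaches_obtain)
  then show ?thesis by (intro bdd_belowI[of _ c0]) (metis linorder_le_cases mem_Collect_eq reaches_mono_c)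
qed

text \<open>The infimum is attained because \<open>R\<close> is nondecreasing in \<open>c\<close>
  and the gap grows at most at unit rate. Thus the sets given by \<open>reaches c\<close> are
  exactly the sublevel sets of \<open>residual\<close>, without any selection of maximizers.\<close>

lemma residual_le_iff: "residual x \<le> c \<longleftrightarrow> reaches c x"
proof
  assume "reaches c x"
  then show "residual x \<le> c"
    unfolding residual_def by (intro cInf_lower bdd_below_reaches) auto
next
  assume "residual x \<le> c"
  have "reaches (residual x) x"
    unfolding reaches_def
  proof (intro allI impI)
    fix e :: real assume e: "e > 0"
    obtain c0 where "reaches c0 x" by (rule reaches_obtain)
    then obtain c' where c': "reaches c' x" "c' < residual x + e / 2"
      using e cInf_less_iff[OF _ bdd_below_reaches, of x "residual x + e / 2"]
      by (auto simp: residual_def)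
    then have "residual x \<le> c'"
      unfolding residual_def by (intro cInf_lower bdd_below_reaches) auto
    moreover obtain x' where "x \<le> x'" "R c' - e / 2 < gap c' x'"
      using reachesD[OF c'(1), of "e / 2"] e by auto
    ultimately show "\<exists>x'\<ge>x. R (residual x) - e < gap (residual x) x'"
      using R_shift[of "residual x" c'] gap_shift_c[of "residual x" c' x'] c'(2)
      by (intro exI[of _ x']) auto
  qed
  then show "reaches c x" using \<open>residual x \<le> c\<close> by (rule reaches_mono_c)
qed

text \<open>Down-closedness of \<open>reaches c\<close> makes \<open>residual\<close> nondecreasing;
  moving \<open>c\<close> and \<open>x\<close> by the same amount bounds its increments by those of
  \<open>x\<close>.\<close>

lemma residual_contraction: "increasing_contraction residual"
  unfolding increasing_contraction_def mono_def
proof (intro conjI allI impI)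
  fix x y :: real assume xy: "x \<le> y"
  show "residual x \<le> residual y"
    unfolding residual_le_iff using residual_le_iff[of y "residual y"] xy by (auto intro: reaches_antimono)
  have "residual y \<le> residual x + (y - x)"
    unfolding residual_le_iff
    using residual_le_iff[of x "residual x"] reaches_mono_shift[of "residual x" x "y - x"] xy by auto
  then show "x - residual x \<le> y - residual y" by simp
qed

lemma residual_measurable [measurable]: "residual \<in> borel_measurable borel"
  by (rule increasing_contraction_measurable[OF residual_contraction])

section \<open>Envelope inequalities for \<open>R\<close>\<close>

lemma R_right:
  assumes "reaches c x" "c \<le> c'"
  shows "R c + (c' - c) * cdf \<mu> x \<le> R c'"
proof (rule field_le_epsilon)
  fix e :: real assume e: "e > 0"
  obtain x' where x': "x \<le> x'" "R c - e < gap c x'" using reachesD[OF assms(1) e] by auto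
  have "(c' - c) * cdf \<mu> x \<le> (c' - c) * cdf \<mu> x'"
    using x' assms by (intro mult_left_mono \<mu>.cdf_nondecreasing) auto
  \<comment> \<open>The near-maximizer moves together with \<open>c\<close>, which freezes the term
    in \<open>\<nu>\<close>; the change comes only from the potential of \<open>\<mu>\<close>, whose
    slope is its distribution function.\<close>
  moreover have "potential \<mu> x' + (x' + (c' - c) - x') * cdf \<mu> x' \<le> potential \<mu> (x' + (c' - c))"
    by (rule potential_subgradient[OF \<mu>])
  moreover have "potential \<mu> (x' + (c' - c)) - potential \<nu> (x' - c) \<le> R c'"
    using gap_le_R[of c' "x' + (c' - c)"] by (simp add: gap_def)
  ultimately show "R c + (c' - c) * cdf \<mu> x \<le> R c' + e" using x' by (simp add: gap_def)
qed

lemma R_left: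
  assumes "\<not> reaches c x" "c' \<le> c"
  shows "R c + (c' - c) * cdf \<mu> x \<le> R c'"
proof (rule field_le_epsilon)
  fix e :: real assume e: "e > 0"
  obtain e' where e': "e' > 0" "\<And>x'. x \<le> x' \<Longrightarrow> gap c x' \<le> R c - e'"
    using assms(1) by (auto simp: reaches_def not_less)
  \<comment> \<open>Accuracy \<open>e'\<close> forces the near-maximizer to the left of
    \<open>x\<close>, since every point from \<open>x\<close> on misses the supremum by at least
    \<open>e'\<close>.\<close>
  obtain x' where x': "R c - min e e' < gap c x'" using R_approx[of "min e e'" c] e e' by auto
  have "x' \<le> x" using e'(2)[of x'] x' by fastforce
  then have "(c - c') * cdf \<mu> x' \<le> (c - c') * cdf \<mu> x"
    using assms by (intro mult_left_mono \<mu>.cdf_nondecreasing) auto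
  moreover have "potential \<mu> x' + (x' + (c' - c) - x') * cdf \<mu> x' \<le> potential \<mu> (x' + (c' - c))"
    by (rule potential_subgradient[OF \<mu>])
  moreover have "potential \<mu> (x' + (c' - c)) - potential \<nu> (x' - c) \<le> R c'"
    using gap_le_R[of c' "x' + (c' - c)"] by (simp add: gap_def)
  ultimately show "R c + (c' - c) * cdf \<mu> x \<le> R c' + e" using x' by (simp add: gap_def algebra_simps)
qed

definition \<rho> :: "real measure" where
  "\<rho> = pushforward residual \<mu>"

lemma \<rho>_P1: "\<rho> \<in> P1"
  unfolding \<rho>_def by (rule pushforward_P1[OF \<mu> residual_contraction])

lemma cdf_\<rho>: "cdf \<rho> c = measure \<mu> {x. reaches c x}"
  unfolding \<rho>_def pushforward_def cdf_def
  by (subst measure_distr) (auto simp: vimage_def residual_le_iff)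

text \<open>The set is down-closed, and closed as a sublevel set of the continuous
  \<open>residual\<close>. Its \<open>\<mu>\<close>-measure is therefore 0, 1 or a value of
  \<open>cdf \<mu>\<close>.\<close>

lemma reaches_cases:
  obtains "{x. reaches c x} = {}" | "{x. reaches c x} = UNIV"
    | b where "{x. reaches c x} = {..b}"
proof -
  let ?E = "{x. reaches c x}"
  have "closed (residual -` {..c})"
    using increasing_contraction_continuous[OF residual_contraction]
    by (intro continuous_closed_vimage) (auto simp: continuous_on_eq_continuous_at)
  moreover have "residual -` {..c} = ?E" by (auto simp: residual_le_iff)
  ultimately have cl: "closed ?E" by simp
  show ?thesis
  proof (cases "?E = {} \<or> ?E = UNIV")
    case False
    then obtain z where z: "\<not> reaches c z" by auto
    have bd: "bdd_above ?E"
      using z by (intro bdd_aboveI[of _ z]) (metis linorder_le_cases mem_Collect_eq reaches_antimono)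
    have "Sup ?E \<in> ?E" using False bd cl by (intro closed_contains_Sup) auto
    then have "?E = {..Sup ?E}" using bd by (auto intro: cSup_upper reaches_antimono)
    then show ?thesis by (rule that(3))
  qed (use that in auto)
qed

text \<open>By the envelope theorem, \<open>R\<close> and the potential of \<open>\<rho>\<close> have a common subgradient.\<close>

lemma R_subgradient: "R c + (c' - c) * cdf \<rho> c \<le> R c'"
proof (cases "c \<le> c'")
  case True
  show ?thesis
  proof (rule reaches_cases[of c])
    assume "{x. reaches c x} = {}"
    then show ?thesis using R_shift(1)[OF True] by (simp add: cdf_\<rho>)
  next
    assume E: "{x. reaches c x} = UNIV"
    then have "\<forall>x. reaches c x" by auto
    then have "R c + (c' - c) * cdf \<mu> x \<le> R c'" for x using R_right True by blast
    moreover have "((\<lambda>x. R c + (c' - c) * cdf \<mu> x) \<longlongrightarrow> R c + (c' - c) * 1) at_top"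
      by (intro tendsto_intros \<mu>.cdf_lim_at_top_prob)
    ultimately have "R c + (c' - c) * 1 \<le> R c'"
      by (intro tendsto_upperbound[where F=at_top]) auto
    then show ?thesis using E by (simp add: cdf_\<rho> \<mu>.prob_space[unfolded \<mu>.space_eq_univ])
  next
    fix b assume E: "{x. reaches c x} = {..b}"
    then have "reaches c b" by auto
    then have "R c + (c' - c) * cdf \<mu> b \<le> R c'" using True by (rule R_right)
    then show ?thesis by (simp only: cdf_\<rho> E cdf_def[of \<mu>])
  qed
next
  case False
  then have c': "c' \<le> c" by simp
  show ?thesis
  proof (rule reaches_cases[of c])
    assume E: "{x. reaches c x} = {}"
    then have "R c + (c' - c) * cdf \<mu> x \<le> R c'" for x using R_left c' by blast
    moreover have "((\<lambda>x. R c + (c' - c) * cdf \<mu> x) \<longlongrightarrow> R c + (c' - c) * 0) at_bot"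
      by (intro tendsto_intros \<mu>.cdf_lim_at_bot)
    ultimately have "R c + (c' - c) * 0 \<le> R c'"
      by (intro tendsto_upperbound[where F=at_bot]) auto
    then show ?thesis using E by (simp add: cdf_\<rho>)
  next
    assume E: "{x. reaches c x} = UNIV"
    then show ?thesis using R_shift(2)[OF c'] by (simp add: cdf_\<rho> \<mu>.prob_space[unfolded \<mu>.space_eq_univ])
  next
    fix b assume E: "{x. reaches c x} = {..b}"
    have nr: "\<not> reaches c x" if "b < x" for x
    proof
      assume "reaches c x"
      then have "x \<in> {..b}" unfolding E[symmetric] by simp
      then show False using that by simp
    qed
    have "((\<lambda>x. R c + (c' - c) * cdf \<mu> x) \<longlongrightarrow> R c + (c' - c) * cdf \<mu> b) (at_right b)"
      using \<mu>.cdf_is_right_cont[of b] by (intro tendsto_intros) (simp add: continuous_within)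
    \<comment> \<open>The left inequality is available only at points that are not reached, so
      \<open>b\<close> is approached from the right and right continuity of \<open>cdf \<mu>\<close>
      passes to the limit.\<close>
    moreover have "\<forall>\<^sub>F x in at_right b. R c + (c' - c) * cdf \<mu> x \<le> R c'"
      using R_left[OF nr c'] by (intro eventually_at_rightI[of b "b + 1"]) auto
    ultimately have "R c + (c' - c) * cdf \<mu> b \<le> R c'"
      by (intro tendsto_upperbound[where F="at_right b"]) auto
    then show ?thesis by (simp only: cdf_\<rho> E cdf_def[of \<mu>])
  qed
qed

end

text \<open>Both increments over an interval lie between its length times \<open>p a\<close> and its
  length times \<open>p b\<close>. Bisection halves the lengths while the slope increments
  telescope, so the bound on the discrepancy is halved each time.\<close>

lemma common_subgradient_const:
  fixes f g p :: "real \<Rightarrow> real"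
  assumes "subgradient f p" "subgradient g p" "a \<le> b"
  shows "f b - f a = g b - g a"
proof -
  have bound: "\<bar>(f b - f a) - (g b - g a)\<bar> \<le> (b - a) * (p b - p a) / 2 ^ n" if "a \<le> b" for n a b
    using that
  proof (induction n arbitrary: a b)
    case 0
    have "f a + p a * (b - a) \<le> f b" "f b + p b * (a - b) \<le> f a"
      "g a + p a * (b - a) \<le> g b" "g b + p b * (a - b) \<le> g a"
      using assms(1,2) unfolding subgradient_def by blast+
    then show ?case by (simp add: algebra_simps abs_le_iff)
  next
    case (Suc n)
    define c where "c = (a + b) / 2"
    have c: "c - a = (b - a) / 2" "b - c = (b - a) / 2" "a \<le> c" "c \<le> b"
      using Suc.prems by (auto simp: c_def field_simps)
    have "\<bar>(f b - f a) - (g b - g a)\<bar>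
        \<le> \<bar>(f c - f a) - (g c - g a)\<bar> + \<bar>(f b - f c) - (g b - g c)\<bar>" by linarith
    also have "\<dots> \<le> (c - a) * (p c - p a) / 2 ^ n + (b - c) * (p b - p c) / 2 ^ n"
      using Suc.IH c by (intro add_mono) auto
    also have "\<dots> = (b - a) * (p b - p a) / 2 ^ Suc n"
      unfolding c(1,2) by (simp add: field_simps)
    finally show ?case .
  qed
  have "(\<lambda>n. (b - a) * (p b - p a) / 2 ^ n) \<longlonglongrightarrow> 0"
    using LIMSEQ_divide_realpow_zero[of 2] by simp
  then have "\<bar>(f b - f a) - (g b - g a)\<bar> \<le> 0"
    by (rule LIMSEQ_le_const) (use bound[OF assms(3)] in auto)
  then show ?thesis by simp
qed

section \<open>Potential and mean of the residual law\<close>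

context transport_pair
begin

text \<open>The difference of the two functions is constant by the common subgradient, and both
  vanish at minus infinity.\<close>

lemma potential_\<rho>: "potential \<rho> c = R c"
proof -
  have sR: "subgradient R (cdf \<rho>)"
    using R_subgradient by (auto simp: subgradient_def mult.commute)
  have s\<rho>: "subgradient (potential \<rho>) (cdf \<rho>)"
    using potential_subgradient[OF \<rho>_P1] by (auto simp: subgradient_def mult.commute)
  have "LIM x at_bot. x + m\<^sub>\<nu> :> at_bot"
    unfolding filterlim_at_bot
  proof
    show "\<forall>\<^sub>F x in at_bot. x + m\<^sub>\<nu> \<le> z" for z
      using eventually_le_at_bot[of "z - m\<^sub>\<nu>"] by eventually_elim simp
  qed
  then have "((\<lambda>x. potential \<mu> (x + m\<^sub>\<nu>)) \<longlongrightarrow> 0) at_bot"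
    by (rule filterlim_compose[OF potential_at_bot[OF \<mu>]])
  then have R0: "(R \<longlongrightarrow> 0) at_bot"
    by (rule tendsto_sandwich[where f="\<lambda>_. 0" and g=R and h="\<lambda>x. potential \<mu> (x + m\<^sub>\<nu>)", rotated 3])
      (simp_all add: R_nonneg R_le_potential)
  have "((\<lambda>x. potential \<rho> x - R x) \<longlongrightarrow> 0 - 0) at_bot"
    by (intro tendsto_intros potential_at_bot[OF \<rho>_P1] R0)
  moreover have "\<forall>\<^sub>F x in at_bot. potential \<rho> x - R x = potential \<rho> c - R c"
    using eventually_le_at_bot[of c]
  proof eventually_elim
    case (elim x)
    then show ?case using common_subgradient_const[OF sR s\<rho> elim] by linarith
  qed
  ultimately have "((\<lambda>_::real. potential \<rho> c - R c) \<longlongrightarrow> 0 - 0) at_bot"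
    by (rule Lim_transform_eventually)
  then show ?thesis by (simp add: tendsto_const_iff)
qed

text \<open>A potential minus its argument tends to minus the mean at plus infinity; for
  \<open>R\<close> this limit is squeezed out of the linear lower bound and the shifted potential of
  \<open>\<mu>\<close>.\<close>

lemma mean_residual: "(\<integral>x. residual x \<partial>\<mu>) = m\<^sub>\<mu> - m\<^sub>\<nu>"
proof -
  have "LIM x at_top. x + m\<^sub>\<nu> :> at_top"
    by (subst add.commute) (rule filterlim_tendsto_add_at_top[OF tendsto_const filterlim_ident])
  then have "((\<lambda>x. potential \<mu> (x + m\<^sub>\<nu>) - (x + m\<^sub>\<nu>)) \<longlongrightarrow> - m\<^sub>\<mu>) at_top"
    by (rule filterlim_compose[OF potential_at_top[OF \<mu>]])
  then have "((\<lambda>x. (potential \<mu> (x + m\<^sub>\<nu>) - (x + m\<^sub>\<nu>)) + m\<^sub>\<nu>) \<longlongrightarrow> - m\<^sub>\<mu> + m\<^sub>\<nu>) at_top"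
    by (rule tendsto_add[OF _ tendsto_const])
  moreover have "- m\<^sub>\<mu> + m\<^sub>\<nu> \<le> R x - x" for x using R_ge_mean[of x] by simp
  ultimately have "((\<lambda>x. R x - x) \<longlongrightarrow> - m\<^sub>\<mu> + m\<^sub>\<nu>) at_top"
    by (intro tendsto_sandwich[where f="\<lambda>_. - m\<^sub>\<mu> + m\<^sub>\<nu>" and g="\<lambda>x. R x - x"
          and h="\<lambda>x. (potential \<mu> (x + m\<^sub>\<nu>) - (x + m\<^sub>\<nu>)) + m\<^sub>\<nu>"]) (simp_all add: R_le_potential)
  moreover have "((\<lambda>x. R x - x) \<longlongrightarrow> - (\<integral>x. x \<partial>\<rho>)) at_top"
    using potential_at_top[OF \<rho>_P1] by (simp add: potential_\<rho>)
  ultimately have "- m\<^sub>\<mu> + m\<^sub>\<nu> = - (\<integral>x. x \<partial>\<rho>)" by (rule tendsto_unique[rotated]) simp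
  then show ?thesis by (simp add: \<rho>_def mean_pushforward[OF \<mu> residual_contraction])
qed

section \<open>Feasibility and maximality of \<open>T\<close>\<close>

definition T :: "real \<Rightarrow> real" where
  "T x = x - residual x"

lemma T_contraction: "increasing_contraction T"
  unfolding T_def[abs_def] by (rule increasing_contraction_residual[OF residual_contraction])

lemma T_measurable [measurable]: "T \<in> borel_measurable borel"
  by (rule increasing_contraction_measurable[OF T_contraction])

lemma residual_eq: "(\<lambda>x. x - T x) = residual"
  by (simp add: T_def)

lemma mean_T: "(\<integral>x. T x \<partial>\<mu>) = m\<^sub>\<nu>"
  unfolding T_def
  using P1_integrable[OF \<mu>] increasing_contraction_integrable[OF \<mu> residual_contraction] mean_residual
  by simp

lemma potential_T: "potential (pushforward T \<mu>) (T x) = potential \<mu> x - R (residual x)"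
  using potential_split_eq[OF \<mu> T_contraction, of x] potential_\<rho>
  by (simp add: residual_eq \<rho>_def) (simp add: T_def)

text \<open>Taking \<open>c = residual x\<close> in \<open>gap_le_R\<close> gives
  \<open>x - c = T x\<close>, so that bound is precisely the comparison of potentials at the values
  of \<open>T\<close>.\<close>

lemma T_convex_le: "pushforward T \<mu> \<le>\<^sub>c \<nu>"
proof (rule pushforward_convex_leI[OF \<mu> T_contraction \<nu> mean_T])
  show "potential (pushforward T \<mu>) (T x) \<le> potential \<nu> (T x)" for x
    unfolding potential_T using gap_le_R[of "residual x" x] by (simp add: gap_def T_def)
qed

text \<open>Every way of splitting \<open>\<mu>\<close> as a sum whose second summand is dominated by \<open>\<nu>\<close> leaves a first
  summand at least as spread out as \<open>residual\<close>; this gives both maximality and optimality.\<close>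

lemma R_le_potential_diff:
  assumes M: "prob_space M" and X: "integrable M X" and Y: "integrable M Y"
    and mar: "distr M borel X = \<mu>" and le: "distr M borel Y \<le>\<^sub>c \<nu>"
  shows "R c \<le> potential (distr M borel (\<lambda>\<omega>. X \<omega> - Y \<omega>)) c"
  unfolding R_le_iff
proof
  fix x
  have "potential \<mu> ((x - c) + c)
      \<le> potential (distr M borel Y) (x - c) + potential (distr M borel (\<lambda>\<omega>. X \<omega> - Y \<omega>)) c"
    using potential_distr_add_le[OF M Y Bochner_Integration.integrable_diff[OF X Y], of "x - c" c] mar
    by simp
  then show "gap c x \<le> potential (distr M borel (\<lambda>\<omega>. X \<omega> - Y \<omega>)) c"
    using convex_le_potential[OF P1_distr[OF M Y] \<nu> le, of "x - c"] by (simp add: gap_def)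
qed

lemma residual_convex_le:
  assumes M: "prob_space M" and X: "integrable M X" and Y: "integrable M Y"
    and mar: "distr M borel X = \<mu>" and le: "distr M borel Y \<le>\<^sub>c \<nu>"
  shows "pushforward residual \<mu> \<le>\<^sub>c distr M borel (\<lambda>\<omega>. X \<omega> - Y \<omega>)"
proof (rule convex_leI[OF pushforward_P1[OF \<mu> residual_contraction]])
  note XY = Bochner_Integration.integrable_diff[OF X Y]
  show "distr M borel (\<lambda>\<omega>. X \<omega> - Y \<omega>) \<in> P1" by (rule P1_distr[OF M XY])
  have "(\<integral>x. x \<partial>distr M borel Y) = m\<^sub>\<nu>" by (rule convex_le_mean[OF P1_distr[OF M Y] \<nu> le])
  moreover have "(\<integral>x. x \<partial>distr M borel X) = m\<^sub>\<mu>" using mar by simp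
  ultimately show "(\<integral>x. x \<partial>pushforward residual \<mu>) = (\<integral>x. x \<partial>distr M borel (\<lambda>\<omega>. X \<omega> - Y \<omega>))"
    using X Y XY by (simp add: mean_pushforward[OF \<mu> residual_contraction] mean_residual mean_distr)
  show "potential (pushforward residual \<mu>) c \<le> potential (distr M borel (\<lambda>\<omega>. X \<omega> - Y \<omega>)) c" for c
    using R_le_potential_diff[OF assms] potential_\<rho> by (simp add: \<rho>_def)
qed

lemma admissible_T: "admissible \<mu> \<nu> T"
  using T_contraction T_convex_le by (simp add: admissible_def increasing_contraction_iff)

text \<open>Two splittings of the potential of \<open>\<mu>\<close> are compared at
  \<open>x = S x + (x - S x)\<close>: the one by \<open>S\<close> is exact there, the one by
  \<open>T\<close> is an upper bound, and the residual of \<open>S\<close> contributes at least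
  \<open>R (x - S x)\<close>, the contribution of the residual of \<open>T\<close>.\<close>

lemma admissible_convex_le_T:
  assumes "admissible \<mu> \<nu> S"
  shows "pushforward S \<mu> \<le>\<^sub>c pushforward T \<mu>"
proof -
  have S: "increasing_contraction S" and le: "pushforward S \<mu> \<le>\<^sub>c \<nu>"
    using assms by (auto simp: admissible_def increasing_contraction_iff)
  note res = increasing_contraction_residual[OF S]
  note PT = pushforward_P1[OF \<mu> T_contraction] and PS = pushforward_P1[OF \<mu> S]
  show ?thesis
  proof (rule pushforward_convex_leI[OF \<mu> S PT])
    have "(\<integral>x. S x \<partial>\<mu>) = m\<^sub>\<nu>"
      using convex_le_mean[OF PS \<nu> le] mean_pushforward[OF \<mu> S] by simp
    then show "(\<integral>x. S x \<partial>\<mu>) = (\<integral>x. x \<partial>pushforward T \<mu>)"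
      by (simp add: mean_pushforward[OF \<mu> T_contraction] mean_T)
    fix x
    have "R (x - S x) \<le> potential (pushforward (\<lambda>x. x - S x) \<mu>) (x - S x)"
      using R_le_potential_diff[OF \<mu>.prob_space_axioms P1_integrable[OF \<mu>]
          increasing_contraction_integrable[OF \<mu> S], of "x - S x"] le
      by (simp add: pushforward_def distr_id2)
    moreover have "potential \<mu> (S x + (x - S x))
        \<le> potential (pushforward T \<mu>) (S x) + potential (pushforward (\<lambda>x. x - T x) \<mu>) (x - S x)"
      by (rule potential_split_le[OF \<mu> T_contraction])
    ultimately show "potential (pushforward S \<mu>) (S x) \<le> potential (pushforward T \<mu>) (S x)"
      using potential_split_eq[OF \<mu> S, of x] potential_\<rho>[of "x - S x"] by (simp add: residual_eq \<rho>_def)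
  qed
qed

lemma maximal_T: "maximal_admissible \<mu> \<nu> T"
  using admissible_T admissible_convex_le_T by (auto simp: maximal_admissible_def)

end

section \<open>Uniqueness of the maximal map\<close>

text \<open>Sublevel sets of nondecreasing functions are down-closed, hence nested; equal measure
  makes their difference null. Countably many rational levels separate distinct values.\<close>

lemma mono_AE_eqI:
  fixes S T :: "real \<Rightarrow> real"
  assumes "real_distribution \<mu>" and S: "mono S" and T: "mono T"
    and law: "distr \<mu> borel S = distr \<mu> borel T"
  shows "AE x in \<mu>. S x = T x"
proof -
  interpret real_distribution \<mu> by fact
  have [measurable]: "S \<in> borel_measurable borel" "T \<in> borel_measurable borel"
    using S T by (auto intro: borel_measurable_mono)
  have null: "AE x in \<mu>. F x \<le> q \<longrightarrow> G x \<le> q"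
    if [measurable]: "F \<in> borel_measurable borel" "G \<in> borel_measurable borel"
      and FG: "mono F" "mono G" "distr \<mu> borel F = distr \<mu> borel G" for F G :: "real \<Rightarrow> real" and q
  proof -
    have "measure (distr \<mu> borel F) {..q} = measure (distr \<mu> borel G) {..q}" using FG by simp
    then have eq: "measure \<mu> {x. F x \<le> q} = measure \<mu> {x. G x \<le> q}"
      by (simp add: measure_distr vimage_def)
    have sets: "{x. F x \<le> q} \<in> sets \<mu>" "{x. G x \<le> q} \<in> sets \<mu>" by auto
    consider "{x. F x \<le> q} \<subseteq> {x. G x \<le> q}" | "{x. G x \<le> q} \<subseteq> {x. F x \<le> q}"
      using FG(1,2) unfolding mono_def by (smt (verit) mem_Collect_eq subsetI)
    then show ?thesis
    proof cases
      case 2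
      then have "measure \<mu> ({x. F x \<le> q} - {x. G x \<le> q}) = 0"
        using eq sets by (subst finite_measure_Diff) auto
      then have "{x. F x \<le> q} - {x. G x \<le> q} \<in> null_sets \<mu>"
        using sets by (auto simp: null_sets_def emeasure_eq_measure)
      then show ?thesis by (rule AE_I') auto
    qed auto
  qed
  have "AE x in \<mu>. \<forall>q\<in>\<rat>. S x \<le> q \<longrightarrow> T x \<le> q" "AE x in \<mu>. \<forall>q\<in>\<rat>. T x \<le> q \<longrightarrow> S x \<le> q"
    using null[of S T] null[of T S] S T law by (auto simp: AE_ball_countable countable_rat)
  then show ?thesis
  proof eventually_elim
    case (elim x)
    show ?case
    proof (rule ccontr)
      assume "S x \<noteq> T x"
      then consider "S x < T x" | "T x < S x" by linarith
      then show False
        using elim Rats_dense_in_real[of "S x" "T x"] Rats_dense_in_real[of "T x" "S x"]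
        by cases (meson less_imp_le not_le)+
    qed
  qed
qed

context transport_pair
begin

lemma maximal_AE_unique:
  assumes "maximal_admissible \<mu> \<nu> S"
  shows "AE x in \<mu>. S x = T x"
proof -
  have adm: "admissible \<mu> \<nu> S" using assms by (simp add: maximal_admissible_def)
  then have S: "increasing_contraction S" by (simp add: admissible_def increasing_contraction_iff)
  note PT = pushforward_P1[OF \<mu> T_contraction] and PS = pushforward_P1[OF \<mu> S]
  have "pushforward T \<mu> \<le>\<^sub>c pushforward S \<mu>"
    using assms admissible_T by (simp add: maximal_admissible_def)
  then have "pushforward S \<mu> = pushforward T \<mu>"
    using admissible_convex_le_T[OF adm]
    by (intro potential_inject PS PT antisym convex_le_potential)
  then show ?thesis
    using S T_contraction unfolding pushforward_def increasing_contraction_def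
    by (intro mono_AE_eqI \<mu>.real_distribution_axioms) auto
qed

end

section \<open>Optimality\<close>

text \<open>A coupling is specified by its marginals alone; total mass one and integrability of the
  coordinates are inherited from them.\<close>

lemma couplingsD:
  assumes "\<pi> \<in> couplings \<mu> \<eta>" "\<mu> \<in> P1" "\<eta> \<in> P1"
  shows "prob_space \<pi>" "integrable \<pi> fst" "integrable \<pi> snd"
    "distr \<pi> borel fst = \<mu>" "distr \<pi> borel snd = \<eta>"
proof -
  have s [measurable_cong]: "sets \<pi> = sets (borel \<Otimes>\<^sub>M borel)"
    and d: "distr \<pi> borel fst = \<mu>" "distr \<pi> borel snd = \<eta>"
    using assms(1) by (auto simp: couplings_def)
  show "distr \<pi> borel fst = \<mu>" "distr \<pi> borel snd = \<eta>" by fact+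
  have m: "fst \<in> borel_measurable \<pi>" "snd \<in> borel_measurable \<pi>" by measurable
  have "prob_space (distr \<pi> borel fst)"
    unfolding d using P1_real_distribution[OF assms(2)] by (simp add: real_distribution_def)
  then show "prob_space \<pi>" by (rule prob_space_distrD[OF m(1)])
  have i: "integrable (distr \<pi> borel fst) (\<lambda>x. x)" "integrable (distr \<pi> borel snd) (\<lambda>x. x)"
    unfolding d using assms(2,3) P1_integrable by blast+
  note eq = integrable_distr_eq[OF _ measurable_ident, unfolded id_def]
  show "integrable \<pi> fst" using i(1) unfolding eq[OF m(1)] .
  show "integrable \<pi> snd" using i(2) unfolding eq[OF m(2)] .
qed

lemma pushforward_coupling:
  assumes "\<pi> \<in> couplings \<mu> \<eta>" and [measurable]: "F \<in> borel_measurable borel"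
  shows "pushforward F \<mu> = distr \<pi> borel (\<lambda>\<omega>. F (fst \<omega>))"
proof -
  have [measurable_cong]: "sets \<pi> = sets (borel \<Otimes>\<^sub>M borel)" and d: "distr \<pi> borel fst = \<mu>"
    using assms(1) by (auto simp: couplings_def)
  show ?thesis unfolding pushforward_def d[symmetric] by (subst distr_distr) (auto simp: comp_def)
qed

lemma ext_integral_coupling:
  fixes \<theta> :: "real \<Rightarrow> real"
  assumes "integrable \<pi> fst" "integrable \<pi> snd" "\<theta> \<in> borel_measurable borel"
  shows "ext_integral \<pi> (\<lambda>(x, y). \<theta> (x - y)) = ext_integral (distr \<pi> borel (\<lambda>\<omega>. fst \<omega> - snd \<omega>)) \<theta>"
  using assms by (subst ext_integral_distr) (auto simp: case_prod_beta')

lemma W_pushforward_le: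
  assumes \<mu>: "\<mu> \<in> P1" and S: "increasing_contraction S" and \<theta>: "\<theta> \<in> borel_measurable borel"
  shows "W \<theta> \<mu> (pushforward S \<mu>) \<le> ext_integral (pushforward (\<lambda>x. x - S x) \<mu>) \<theta>"
proof -
  interpret real_distribution \<mu> by (rule P1_real_distribution[OF \<mu>])
  have [measurable]: "S \<in> borel_measurable borel" by (rule increasing_contraction_measurable[OF S])
  let ?\<pi> = "distr \<mu> (borel \<Otimes>\<^sub>M borel) (\<lambda>x. (x, S x))"
  have "?\<pi> \<in> couplings \<mu> (pushforward S \<mu>)"
    by (auto simp: couplings_def pushforward_def distr_distr comp_def distr_id2)
  then have "W \<theta> \<mu> (pushforward S \<mu>) \<le> ext_integral ?\<pi> (\<lambda>(x, y). \<theta> (x - y))"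
    unfolding W_def by (rule INF_lower)
  also have "\<dots> = ext_integral (pushforward (\<lambda>x. x - S x) \<mu>) \<theta>"
    using \<theta> by (simp add: pushforward_def ext_integral_def nn_integral_distr case_prod_beta')
  finally show ?thesis .
qed

context transport_pair
begin

lemma coupling_cost_ge:
  assumes "convex_on UNIV \<theta>" "\<eta> \<in> P1" "\<eta> \<le>\<^sub>c \<nu>" "\<pi> \<in> couplings \<mu> \<eta>"
  shows "ext_integral \<rho> \<theta> \<le> ext_integral \<pi> (\<lambda>(x, y). \<theta> (x - y))"
proof -
  note \<pi> = couplingsD[OF assms(4) \<mu> assms(2)]
  have "pushforward residual \<mu> \<le>\<^sub>c distr \<pi> borel (\<lambda>\<omega>. fst \<omega> - snd \<omega>)"
    using \<pi> assms(3) by (intro residual_convex_le) auto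
  then show ?thesis
    using assms(1) unfolding ext_integral_coupling[OF \<pi>(2,3) convex_measurable[OF assms(1)]]
    by (auto simp: convex_le_def \<rho>_def)
qed

text \<open>The cost of \<open>\<rho>\<close> bounds every feasible coupling from below and is
  attained by the one on the graph of \<open>T\<close>. The chain of inequalities closes for
  infinite values too.\<close>

lemma V_eq:
  assumes "convex_on UNIV \<theta>"
  shows "V \<theta> \<mu> \<nu> = ext_integral \<rho> \<theta>" "W \<theta> \<mu> (pushforward T \<mu>) = V \<theta> \<mu> \<nu>"
proof -
  have "ext_integral \<rho> \<theta> \<le> V \<theta> \<mu> \<nu>"
    unfolding V_def W_def using coupling_cost_ge[OF assms] by (auto intro!: INF_greatest)
  moreover have "W \<theta> \<mu> (pushforward T \<mu>) \<le> ext_integral \<rho> \<theta>"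
    using W_pushforward_le[OF \<mu> T_contraction convex_measurable[OF assms]]
    by (simp add: residual_eq \<rho>_def)
  moreover have "V \<theta> \<mu> \<nu> \<le> W \<theta> \<mu> (pushforward T \<mu>)"
    unfolding V_def using pushforward_P1[OF \<mu> T_contraction] T_convex_le by (auto intro!: INF_lower)
  ultimately show "V \<theta> \<mu> \<nu> = ext_integral \<rho> \<theta>" "W \<theta> \<mu> (pushforward T \<mu>) = V \<theta> \<mu> \<nu>" by auto
qed

lemma V_optimizer_T:
  assumes "convex_on UNIV \<theta>"
  shows "V_optimizer \<theta> \<mu> \<nu> (pushforward T \<mu>)"
  using V_eq(2)[OF assms] pushforward_P1[OF \<mu> T_contraction] T_convex_le
  by (simp add: V_optimizer_def)

end

section \<open>Uniqueness of the optimizer\<close>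

lemma strictly_convex_imp_convex: "strictly_convex f \<Longrightarrow> convex_on UNIV f"
  unfolding convex_on_def strictly_convex_def
proof (intro conjI ballI allI impI)
  fix x y u v :: real
  assume f: "\<forall>x y u v. x \<noteq> y \<longrightarrow> 0 < u \<longrightarrow> 0 < v \<longrightarrow> u + v = 1 \<longrightarrow> f (u * x + v * y) < u * f x + v * f y"
    and uv: "0 \<le> u" "0 \<le> v" "u + v = 1"
  show "f (u *\<^sub>R x + v *\<^sub>R y) \<le> u * f x + v * f y"
  proof (cases "x = y \<or> u = 0 \<or> v = 0")
    case True
    have "u * z + v * z = z" for z using uv(3) by (metis distrib_right mult_1)
    then show ?thesis using True uv by auto
  next
    case False
    then show ?thesis using f uv by (simp add: less_imp_le)
  qed
qed auto

text \<open>The midpoint gain is continuous and positive on the compact set of pairs in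
  \<open>{-K..K}\<close> that are at least \<open>h\<close> apart, so it has a positive minimum
  there.\<close>

lemma strictly_convex_midpoint_gap:
  assumes "strictly_convex \<theta>" "h > 0"
  obtains \<delta> where "\<delta> > 0"
    "\<And>a b. \<bar>a\<bar> \<le> K \<Longrightarrow> \<bar>b\<bar> \<le> K \<Longrightarrow> h \<le> \<bar>a - b\<bar> \<Longrightarrow> \<delta> \<le> (\<theta> a + \<theta> b) / 2 - \<theta> ((a + b) / 2)"
proof -
  define D where "D = (\<lambda>q. (\<theta> (fst q) + \<theta> (snd q)) / 2 - \<theta> ((fst q + snd q) / 2))"
  define C where "C = ({-K..K} \<times> {-K..K}) \<inter> {q. h \<le> \<bar>fst q - snd q\<bar>}"
  have cont: "continuous_on UNIV \<theta>"
    by (intro convex_continuous_real strictly_convex_imp_convex assms)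
  have D: "continuous_on C D"
    unfolding D_def by (intro continuous_intros continuous_on_compose2[OF cont]) auto
  have C: "compact C"
    unfolding C_def by (intro compact_Int_closed compact_Times closed_Collect_le continuous_intros) auto
  show ?thesis
  proof (cases "C = {}")
    case True
    show ?thesis
    proof (rule that[of 1])
      fix a b assume "\<bar>a\<bar> \<le> K" "\<bar>b\<bar> \<le> K" "h \<le> \<bar>a - b\<bar>"
      then have "(a, b) \<in> C" by (auto simp: C_def)
      then show "1 \<le> (\<theta> a + \<theta> b) / 2 - \<theta> ((a + b) / 2)" using True by simp
    qed simp
  next
    case False
    then obtain q where q: "q \<in> C" "\<And>q'. q' \<in> C \<Longrightarrow> D q \<le> D q'"
      using continuous_attains_inf[OF C False D] by auto
    have "fst q \<noteq> snd q" using q(1) assms(2) by (auto simp: C_def)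
    then have "\<theta> (1 / 2 * fst q + 1 / 2 * snd q) < 1 / 2 * \<theta> (fst q) + 1 / 2 * \<theta> (snd q)"
      using assms(1)[unfolded strictly_convex_def, rule_format, of "fst q" "snd q" "1 / 2" "1 / 2"] by simp
    then have "D q > 0" by (simp add: D_def add_divide_distrib)
    then show ?thesis
    proof (rule that)
      fix a b assume "\<bar>a\<bar> \<le> K" "\<bar>b\<bar> \<le> K" "h \<le> \<bar>a - b\<bar>"
      then have "(a, b) \<in> C" by (auto simp: C_def)
      then show "D q \<le> (\<theta> a + \<theta> b) / 2 - \<theta> ((a + b) / 2)" using q(2)[of "(a, b)"] by (simp add: D_def)
    qed
  qed
qed

lemma ext_integral_mono:
  assumes "\<And>x. f x \<le> g x"
  shows "ext_integral M f \<le> ext_integral M g"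
  unfolding ext_integral_def using assms
  by (intro ereal_minus_mono) (auto simp: less_eq_ennreal.rep_eq[symmetric] intro!: nn_integral_mono ennreal_leI)

text \<open>Infinity minus infinity evaluates to infinity in \<open>ereal\<close>, so a finite value
  forces both parts to be finite.\<close>

lemma ext_integral_finite_imp_integrable:
  assumes "f \<in> borel_measurable M" "\<bar>ext_integral M f\<bar> \<noteq> \<infinity>"
  shows "integrable M f"
proof -
  have "(\<integral>\<^sup>+x. ennreal (f x) \<partial>M) \<noteq> \<infinity>" "(\<integral>\<^sup>+x. ennreal (- f x) \<partial>M) \<noteq> \<infinity>"
    using assms(2) unfolding ext_integral_def
    by (cases "\<integral>\<^sup>+x. ennreal (f x) \<partial>M"; cases "\<integral>\<^sup>+x. ennreal (- f x) \<partial>M"; auto)+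
  then show ?thesis using assms(1) by (simp add: real_integrable_def)
qed

lemma cdf_le_of_close:
  assumes "prob_space M" and [measurable]: "X \<in> borel_measurable M" "Y \<in> borel_measurable M"
  shows "cdf (distr M borel X) c
    \<le> cdf (distr M borel Y) (c + h) + measure M {\<omega> \<in> space M. h \<le> \<bar>X \<omega> - Y \<omega>\<bar>}"
proof -
  interpret prob_space M by fact
  have "measure M {\<omega> \<in> space M. X \<omega> \<le> c}
      \<le> measure M ({\<omega> \<in> space M. Y \<omega> \<le> c + h} \<union> {\<omega> \<in> space M. h \<le> \<bar>X \<omega> - Y \<omega>\<bar>})"
    by (intro finite_measure_mono) auto
  also have "\<dots> \<le> measure M {\<omega> \<in> space M. Y \<omega> \<le> c + h} + measure M {\<omega> \<in> space M. h \<le> \<bar>X \<omega> - Y \<omega>\<bar>}"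
    by (intro measure_Un_le) auto
  finally show ?thesis
    by (simp add: cdf_def measure_distr vimage_def Int_def conj_commute)
qed

context transport_pair
begin

text \<open>The average is one of random variables, not of laws; convexity of the put payoff bounds
  its potential by the mean of the two potentials.\<close>

lemma midpoint_convex_le:
  assumes "prob_space M" and X: "integrable M X" and Y: "integrable M Y"
    and le: "distr M borel X \<le>\<^sub>c \<nu>" "distr M borel Y \<le>\<^sub>c \<nu>"
  shows "distr M borel (\<lambda>\<omega>. (X \<omega> + Y \<omega>) / 2) \<le>\<^sub>c \<nu>"
proof (rule convex_leI)
  interpret prob_space M by fact
  note i = integrable_put[OF finite_measure_axioms]
  note PX = P1_distr[OF assms(1) X] and PY = P1_distr[OF assms(1) Y]
  have XY: "integrable M (\<lambda>\<omega>. (X \<omega> + Y \<omega>) / 2)" using X Y by auto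
  then show "distr M borel (\<lambda>\<omega>. (X \<omega> + Y \<omega>) / 2) \<in> P1" by (rule P1_distr[OF assms(1)])
  show "(\<integral>x. x \<partial>distr M borel (\<lambda>\<omega>. (X \<omega> + Y \<omega>) / 2)) = m\<^sub>\<nu>"
    using convex_le_mean[OF PX \<nu> le(1)] convex_le_mean[OF PY \<nu> le(2)] X Y XY by (simp add: mean_distr)
  fix c
  have "(\<integral>\<omega>. max 0 (c - (X \<omega> + Y \<omega>) / 2) \<partial>M) \<le> (\<integral>\<omega>. (max 0 (c - X \<omega>) + max 0 (c - Y \<omega>)) / 2 \<partial>M)"
    by (intro integral_mono i XY integrable_divide Bochner_Integration.integrable_add X Y) (auto simp: max_def field_simps)
  also have "\<dots> = (potential (distr M borel X) c + potential (distr M borel Y) c) / 2"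
    using X Y i[OF X] i[OF Y] by (simp add: potential_distr)
  also have "\<dots> \<le> potential \<nu> c"
    using convex_le_potential[OF PX \<nu> le(1), of c] convex_le_potential[OF PY \<nu> le(2), of c] by simp
  finally show "potential (distr M borel (\<lambda>\<omega>. (X \<omega> + Y \<omega>) / 2)) c \<le> potential \<nu> c"
    using X Y by (simp add: potential_distr)
qed (rule \<nu>)

text \<open>Replacing \<open>y\<close> by \<open>(y + T x) / 2\<close> keeps a competitor feasible, so a nearly optimal coupling
  can have only a small strict convexity gain, i.e. must be concentrated near the graph of \<open>T\<close>.
  This avoids having to know that an optimal coupling exists.\<close>

lemma near_optimal_coupling:
  assumes strict: "strictly_convex \<theta>" and fin: "\<bar>V \<theta> \<mu> \<nu>\<bar> \<noteq> \<infinity>"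
    and opt: "V_optimizer \<theta> \<mu> \<nu> \<eta>" and h: "h > 0" and e: "e > 0"
  obtains \<pi> where "\<pi> \<in> couplings \<mu> \<eta>"
    "measure \<pi> {\<omega> \<in> space \<pi>. h \<le> \<bar>snd \<omega> - T (fst \<omega>)\<bar>} < e"
proof -
  have cvx: "convex_on UNIV \<theta>" by (rule strictly_convex_imp_convex[OF strict])
  have [measurable]: "\<theta> \<in> borel_measurable borel" by (rule convex_measurable[OF cvx])
  have \<eta>: "\<eta> \<in> P1" "\<eta> \<le>\<^sub>c \<nu>" and W: "W \<theta> \<mu> \<eta> = ext_integral \<rho> \<theta>"
    using opt V_eq(1)[OF cvx] by (auto simp: V_optimizer_def)
  have fin\<rho>: "\<bar>ext_integral \<rho> \<theta>\<bar> \<noteq> \<infinity>" using fin V_eq(1)[OF cvx] by simp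
  have int\<rho>: "integrable \<rho> \<theta>"
    using fin\<rho> by (intro ext_integral_finite_imp_integrable) (auto simp: \<rho>_def pushforward_def)
  define v where "v = (\<integral>x. \<theta> x \<partial>\<rho>)"
  have v: "ext_integral \<rho> \<theta> = ereal v"
    unfolding v_def by (rule ext_integral_eq_lebesgue_integral[OF int\<rho>])
  \<comment> \<open>\<open>C\<close> will be the expectation of \<open>Z\<close>, which dominates
    both displacements below. The added 1 in \<open>K\<close> keeps \<open>K\<close> positive and
    makes the Markov bound \<open>C / K\<close> strictly smaller than \<open>e / 2\<close>.\<close>
  define C where "C = (\<integral>x. \<bar>x\<bar> \<partial>\<mu>) + (\<integral>x. \<bar>x\<bar> \<partial>\<eta>) + \<bar>residual 0\<bar>"
  have C0: "0 \<le> C" unfolding C_def by (intro add_nonneg_nonneg Bochner_Integration.integral_nonneg) auto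
  define K where "K = 2 * (C + 1) / e"
  have K: "K > 0" "C / K < e / 2" using e C0 by (auto simp: K_def field_simps)
  obtain \<delta> where \<delta>: "\<delta> > 0" "\<And>a b. \<bar>a\<bar> \<le> K \<Longrightarrow> \<bar>b\<bar> \<le> K \<Longrightarrow> h \<le> \<bar>a - b\<bar> \<Longrightarrow>
      \<delta> \<le> (\<theta> a + \<theta> b) / 2 - \<theta> ((a + b) / 2)"
    by (rule strictly_convex_midpoint_gap[OF strict h, of K]) blast
  \<comment> \<open>Averaging with the optimal cost halves the excess \<open>e * \<delta>\<close>,
    and division by \<open>\<delta>\<close> then leaves \<open>e / 2\<close>.\<close>
  have "W \<theta> \<mu> \<eta> < ereal (v + e * \<delta>)" using W v e \<delta>(1) by simp
  then obtain \<pi> where \<pi>: "\<pi> \<in> couplings \<mu> \<eta>"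
    and cost: "ext_integral \<pi> (\<lambda>(x, y). \<theta> (x - y)) < ereal (v + e * \<delta>)"
    unfolding W_def INF_less_iff by auto
  note \<pi>' = couplingsD[OF \<pi> \<mu> \<eta>(1)]
  interpret \<pi>: prob_space \<pi> by fact
  note [measurable] = borel_measurable_integrable[OF \<pi>'(2)] borel_measurable_integrable[OF \<pi>'(3)]
  \<comment> \<open>Displacements of the competitor and of \<open>T\<close>; their average is the
    displacement of the midpoint plan, whose cost is again at least \<open>v\<close>.\<close>
  define a where "a = (\<lambda>\<omega>::real \<times> real. fst \<omega> - snd \<omega>)"
  define b where "b = (\<lambda>\<omega>::real \<times> real. residual (fst \<omega>))"
  have [measurable]: "a \<in> borel_measurable \<pi>" "b \<in> borel_measurable \<pi>" unfolding a_def b_def by measurable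
  define \<Delta> where "\<Delta> = (\<lambda>\<omega>. (\<theta> (a \<omega>) + \<theta> (b \<omega>)) / 2 - \<theta> ((a \<omega> + b \<omega>) / 2))"
  have cost': "ext_integral \<pi> (\<lambda>\<omega>. \<theta> (a \<omega>)) < ereal (v + e * \<delta>)"
    using cost by (simp add: a_def case_prod_beta')
  have "ereal v \<le> ext_integral \<pi> (\<lambda>\<omega>. \<theta> (a \<omega>))"
    using coupling_cost_ge[OF cvx \<eta> \<pi>] v by (simp add: a_def case_prod_beta')
  then have int_a: "integrable \<pi> (\<lambda>\<omega>. \<theta> (a \<omega>))"
    using cost' by (intro ext_integral_finite_imp_integrable) auto
  have \<rho>_eq: "\<rho> = distr \<pi> borel b"
    unfolding \<rho>_def b_def by (rule pushforward_coupling[OF \<pi> residual_measurable])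
  have int_b: "integrable \<pi> (\<lambda>\<omega>. \<theta> (b \<omega>))" and v_b: "(\<integral>\<omega>. \<theta> (b \<omega>) \<partial>\<pi>) = v"
    using int\<rho> unfolding v_def \<rho>_eq by (auto simp: integrable_distr_eq integral_distr)
  have law_TX: "distr \<pi> borel (\<lambda>\<omega>. T (fst \<omega>)) = pushforward T \<mu>"
    by (rule pushforward_coupling[OF \<pi> T_measurable, symmetric])
  have "integrable (distr \<pi> borel (\<lambda>\<omega>. T (fst \<omega>))) (\<lambda>x. x)"
    unfolding law_TX by (rule P1_integrable[OF pushforward_P1[OF \<mu> T_contraction]])
  then have TX: "integrable \<pi> (\<lambda>\<omega>. T (fst \<omega>))"
    by (subst (asm) integrable_distr_eq) auto
  have mid: "distr \<pi> borel (\<lambda>\<omega>. (snd \<omega> + T (fst \<omega>)) / 2) \<le>\<^sub>c \<nu>"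
    using \<pi>' TX law_TX T_convex_le \<eta> by (intro midpoint_convex_le) auto
  have ab: "(a \<omega> + b \<omega>) / 2 = fst \<omega> - (snd \<omega> + T (fst \<omega>)) / 2" for \<omega>
    by (simp add: a_def b_def T_def field_simps)
  have "pushforward residual \<mu> \<le>\<^sub>c distr \<pi> borel (\<lambda>\<omega>. fst \<omega> - (snd \<omega> + T (fst \<omega>)) / 2)"
    using \<pi>' TX mid by (intro residual_convex_le) auto
  then have v_le: "ereal v \<le> ext_integral \<pi> (\<lambda>\<omega>. \<theta> ((a \<omega> + b \<omega>) / 2))"
    using cvx unfolding convex_le_def v[symmetric] \<rho>_def ab
    by (auto simp: ext_integral_distr)
  have mid_le: "\<theta> ((a \<omega> + b \<omega>) / 2) \<le> (\<theta> (a \<omega>) + \<theta> (b \<omega>)) / 2" for \<omega>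
    using convex_onD[OF cvx, of "1 / 2" "a \<omega>" "b \<omega>"] by (simp add: field_simps)
  have "ext_integral \<pi> (\<lambda>\<omega>. \<theta> ((a \<omega> + b \<omega>) / 2)) \<le> ext_integral \<pi> (\<lambda>\<omega>. (\<theta> (a \<omega>) + \<theta> (b \<omega>)) / 2)"
    by (intro ext_integral_mono mid_le)
  also have "\<dots> = ereal ((\<integral>\<omega>. \<theta> (a \<omega>) \<partial>\<pi>) / 2 + v / 2)"
    using int_a int_b v_b by (subst ext_integral_eq_lebesgue_integral) (auto simp: add_divide_distrib)
  finally have "\<bar>ext_integral \<pi> (\<lambda>\<omega>. \<theta> ((a \<omega> + b \<omega>) / 2))\<bar> \<noteq> \<infinity>" using v_le by auto
  then have int_mid: "integrable \<pi> (\<lambda>\<omega>. \<theta> ((a \<omega> + b \<omega>) / 2))"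
    by (intro ext_integral_finite_imp_integrable) auto
  then have "v \<le> (\<integral>\<omega>. \<theta> ((a \<omega> + b \<omega>) / 2) \<partial>\<pi>)"
    using v_le by (simp add: ext_integral_eq_lebesgue_integral)
  moreover have "(\<integral>\<omega>. \<theta> (a \<omega>) \<partial>\<pi>) < v + e * \<delta>"
    using cost' int_a by (simp add: ext_integral_eq_lebesgue_integral)
  ultimately have gain: "(\<integral>\<omega>. \<Delta> \<omega> \<partial>\<pi>) < e * \<delta> / 2"
    unfolding \<Delta>_def using int_a int_b int_mid v_b by (simp add: add_divide_distrib)
  have int_\<Delta>: "integrable \<pi> \<Delta>" unfolding \<Delta>_def using int_a int_b int_mid by auto
  have \<Delta>0: "0 \<le> \<Delta> \<omega>" for \<omega> using mid_le[of \<omega>] by (simp add: \<Delta>_def)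
  define Z where "Z = (\<lambda>\<omega>::real \<times> real. \<bar>fst \<omega>\<bar> + \<bar>snd \<omega>\<bar> + \<bar>residual 0\<bar>)"
  have int_Z: "integrable \<pi> Z" unfolding Z_def using \<pi>'(2,3) by auto
  have "(\<integral>x. \<bar>x\<bar> \<partial>\<mu>) = (\<integral>\<omega>. \<bar>fst \<omega>\<bar> \<partial>\<pi>)" "(\<integral>x. \<bar>x\<bar> \<partial>\<eta>) = (\<integral>\<omega>. \<bar>snd \<omega>\<bar> \<partial>\<pi>)"
    unfolding \<pi>'(4,5)[symmetric] by (auto simp: integral_distr)
  then have Z_C: "(\<integral>\<omega>. Z \<omega> \<partial>\<pi>) = C"
    unfolding Z_def C_def using \<pi>'(2,3) by (simp add: \<pi>.prob_space)
  let ?B = "{\<omega> \<in> space \<pi>. h \<le> \<bar>snd \<omega> - T (fst \<omega>)\<bar>}"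
  have B: "?B \<in> sets \<pi>" by measurable
  \<comment> \<open>On the bad set either \<open>Z\<close> exceeds \<open>K\<close>, or both
    displacements stay in the range where the gain is at least \<open>\<delta>\<close>.\<close>
  have point: "indicator ?B \<omega> \<le> Z \<omega> / K + \<Delta> \<omega> / \<delta>" for \<omega>
  proof -
    have Z0: "0 \<le> Z \<omega>" by (simp add: Z_def)
    have d: "\<bar>a \<omega> - b \<omega>\<bar> = \<bar>snd \<omega> - T (fst \<omega>)\<bar>" by (simp add: a_def b_def T_def)
    have aZ: "\<bar>a \<omega>\<bar> \<le> Z \<omega>" "\<bar>b \<omega>\<bar> \<le> Z \<omega>"
      using increasing_contraction_abs[OF residual_contraction, of "fst \<omega>"]
      by (auto simp: a_def b_def Z_def)
    consider "\<omega> \<notin> ?B" | "K \<le> Z \<omega>" | "\<omega> \<in> ?B" "Z \<omega> \<le> K" by linarith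
    then show ?thesis
    proof cases
      case 1
      then show ?thesis using Z0 \<Delta>0 K \<delta>(1) by simp
    next
      case 2
      then have "1 \<le> Z \<omega> / K" "0 \<le> \<Delta> \<omega> / \<delta>" using K \<Delta>0 \<delta>(1) by simp_all
      then show ?thesis by (simp add: indicator_def)
    next
      case 3
      then have "\<delta> \<le> \<Delta> \<omega>"
        unfolding \<Delta>_def using aZ d by (intro \<delta>(2)) auto
      then have "1 \<le> \<Delta> \<omega> / \<delta>" "0 \<le> Z \<omega> / K" using \<delta>(1) K Z0 by simp_all
      then show ?thesis by (simp add: indicator_def)
    qed
  qed
  have "measure \<pi> ?B = (\<integral>\<omega>. indicator ?B \<omega> \<partial>\<pi>)" using B by simp
  also have "\<dots> \<le> (\<integral>\<omega>. Z \<omega> / K + \<Delta> \<omega> / \<delta> \<partial>\<pi>)"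
    using int_Z int_\<Delta> B point
    by (intro integral_mono) (auto intro!: integrable_real_indicator simp: \<pi>.emeasure_eq_measure)
  also have "\<dots> = C / K + (\<integral>\<omega>. \<Delta> \<omega> \<partial>\<pi>) / \<delta>" using int_Z int_\<Delta> Z_C by simp
  also have "\<dots> < e / 2 + e / 2"
    using K(2) gain \<delta>(1) by (intro add_strict_mono) (auto simp: field_simps)
  finally show ?thesis by (intro that[OF \<pi>]) simp
qed

text \<open>Concentration near the graph of \<open>T\<close> makes the two distribution functions
  close up to a shift \<open>h\<close> and an error \<open>e\<close>. The error is sent to 0 first,
  then the shift by right continuity.\<close>

lemma V_optimizer_unique:
  assumes "strictly_convex \<theta>" "\<bar>V \<theta> \<mu> \<nu>\<bar> \<noteq> \<infinity>" and opt: "V_optimizer \<theta> \<mu> \<nu> \<eta>"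
  shows "\<eta> = pushforward T \<mu>"
proof -
  have \<eta>: "\<eta> \<in> P1" using opt by (simp add: V_optimizer_def)
  note PT = pushforward_P1[OF \<mu> T_contraction]
  note rd = P1_real_distribution[OF \<eta>] P1_real_distribution[OF PT]
  have both: "cdf \<eta> c \<le> cdf (pushforward T \<mu>) (c + h) + e \<and> cdf (pushforward T \<mu>) c \<le> cdf \<eta> (c + h) + e"
    if h: "h > 0" and e: "e > 0" for c h e
  proof -
    obtain \<pi> where \<pi>: "\<pi> \<in> couplings \<mu> \<eta>"
      and small: "measure \<pi> {\<omega> \<in> space \<pi>. h \<le> \<bar>snd \<omega> - T (fst \<omega>)\<bar>} < e"
      by (rule near_optimal_coupling[OF assms h e])
    note \<pi>' = couplingsD[OF \<pi> \<mu> \<eta>]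
    have m: "(\<lambda>\<omega>. T (fst \<omega>)) \<in> borel_measurable \<pi>" "snd \<in> borel_measurable \<pi>"
      using \<pi>'(2,3) by (auto intro: measurable_compose[OF _ T_measurable])
    have law: "distr \<pi> borel (\<lambda>\<omega>. T (fst \<omega>)) = pushforward T \<mu>"
      by (rule pushforward_coupling[OF \<pi> T_measurable, symmetric])
    show ?thesis
      using cdf_le_of_close[OF \<pi>'(1) m, of c h] cdf_le_of_close[OF \<pi>'(1) m(2,1), of c h] small
      unfolding law \<pi>'(5) by (simp add: abs_minus_commute)
  qed
  show ?thesis
  proof (intro cdf_unique rd ext antisym)
    show "cdf \<eta> c \<le> cdf (pushforward T \<mu>) c" for c
      using both by (intro cdf_le_from_right rd) (auto intro: field_le_epsilon)
    show "cdf (pushforward T \<mu>) c \<le> cdf \<eta> c" for c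
      using both by (intro cdf_le_from_right rd) (auto intro: field_le_epsilon)
  qed
qed

end

theorem theorem1p2:
  fixes \<mu> \<nu> :: "real measure"
  assumes "\<mu> \<in> P1" and "\<nu> \<in> P1"
  shows "\<exists>T :: real \<Rightarrow> real.
    maximal_admissible \<mu> \<nu> T \<and>
    (\<forall>T'. maximal_admissible \<mu> \<nu> T' \<longrightarrow> (AE x in \<mu>. T' x = T x)) \<and>
    (\<forall>\<theta> :: real \<Rightarrow> real. convex_on UNIV \<theta> \<longrightarrow> V_optimizer \<theta> \<mu> \<nu> (pushforward T \<mu>)) \<and>
    (\<forall>\<theta> :: real \<Rightarrow> real. strictly_convex \<theta> \<and> \<bar>V \<theta> \<mu> \<nu>\<bar> \<noteq> \<infinity> \<longrightarrow>
       (\<forall>\<eta>. V_optimizer \<theta> \<mu> \<nu> \<eta> \<longleftrightarrow> \<eta> = pushforward T \<mu>))"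
proof -
  interpret transport_pair \<mu> \<nu> using assms by unfold_locales
  show ?thesis
  proof (intro exI[of _ T] conjI allI impI iffI)
    show "maximal_admissible \<mu> \<nu> T" by (rule maximal_T)
    show "AE x in \<mu>. T' x = T x" if "maximal_admissible \<mu> \<nu> T'" for T'
      using that by (rule maximal_AE_unique)
    show "V_optimizer \<theta> \<mu> \<nu> (pushforward T \<mu>)" if "convex_on UNIV \<theta>" for \<theta>
      using that by (rule V_optimizer_T)
    show "\<eta> = pushforward T \<mu>"
      if "strictly_convex \<theta> \<and> \<bar>V \<theta> \<mu> \<nu>\<bar> \<noteq> \<infinity>" "V_optimizer \<theta> \<mu> \<nu> \<eta>" for \<theta> \<eta>
      using that by (auto intro: V_optimizer_unique)
    show "V_optimizer \<theta> \<mu> \<nu> \<eta>"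
      if "strictly_convex \<theta> \<and> \<bar>V \<theta> \<mu> \<nu>\<bar> \<noteq> \<infinity>" "\<eta> = pushforward T \<mu>" for \<theta> \<eta>
      using that by (auto intro: V_optimizer_T strictly_convex_imp_convex)
  qed
qed

end
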